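(* There exists a deterministic online algorithm for the (hard) $3$-taxi problem that is $O(1)$-competitive on every metric space. That is, there is an absolute constant $\rho$ (independent of the metric space) and a deterministic online algorithm such that for every metric space $(S,d)$, every initial configuration $C_0$ of $3$ taxis, and every finite request sequence $(r_1,s_1),\dots,(r_T,s_T)$, the cost of the algorithm satisfies $\mathrm{COST}\le \rho\cdot \mathrm{OPT}+c$, where $\mathrm{OPT}$ is the cost of an optimal offline solution and $c$ is a constant that may depend only on the metric space and the initial configuration, but not on the request sequence.
   Context: Let $(S,d)$ be a metric space (arbitrary, possibly infinite). A configuration is a multiset of $k$ points of $S$ (locations of $k$ taxis); here $k=3$. For configurations $C,C'$, $d(C,C')$ denotes the minimum weight of a perfect matching between them with edge weights given by $d$. An instance of the $k$-taxi problem consists of an initial configuration $C_0$ and a sequence of requests $(r_1,s_1),\dots,(r_T,s_T)$, each a pair of points of $S$ (pick-up point $r_t$, drop-off point $s_t$). An algorithm serves the sequence by outputting configurations $\hat C_1,\dots,\hat C_T$ with $r_t\in \hat C_t$ for all $t$; after reaching $\hat C_t$, the taxi at $r_t$ carries the passenger to $s_t$, so the configuration becomes $C_t=\hat C_t - r_t + s_t$ (remove one copy of $r_t$, add one copy of $s_t$). In the hard version of the problem considered here, the cost of the algorithm is $\sum_{t=1}^T d(C_{t-1},\hat C_t)$, i.e., only the distance traveled without a passenger counts. An online algorithm must choose $\hat C_t$ after the request $(r_t,s_t)$ is revealed, without knowledge of future requests; a deterministic online algorithm makes these choices deterministically. An offline algorithm knows the whole sequence in advance; $\mathrm{OPT}$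 denotes the minimum possible cost over all ways to serve the sequence. *)

theory Defs
  imports "HOL-Analysis.Analysis" "HOL-Library.Multiset"
begin

definition perfect_matchings :: "'a multiset \<Rightarrow> 'a multiset \<Rightarrow> ('a \<times> 'a) multiset set" where
  "perfect_matchings C D = {N. image_mset fst N = C \<and> image_mset snd N = D}"

definition matching_dist :: "('a \<Rightarrow> 'a \<Rightarrow> real) \<Rightarrow> 'a multiset \<Rightarrow> 'a multiset \<Rightarrow> real" where
  "matching_dist d C D = Min ((\<lambda>N. \<Sum>(x, y)\<in>#N. d x y) ` perfect_matchings C D)"

(* The minimum above ranges over a finite set, nonempty for configurations of equal size. *)
lemma finite_perfect_matchings: "finite (perfect_matchings C D)"
proof (rule finite_subset)
  show "perfect_matchings C D \<subseteq> multisets_of_size (set_mset C \<times> set_mset D) (size C)"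
  proof
    fix N assume "N \<in> perfect_matchings C D"
    then have C: "C = image_mset fst N" and D: "D = image_mset snd N"
      by (auto simp: perfect_matchings_def)
    show "N \<in> multisets_of_size (set_mset C \<times> set_mset D) (size C)"
      unfolding multisets_of_size_def C D by (force simp: image_iff)
  qed
qed (simp add: finite_multisets_of_size)

lemma perfect_matchings_nonempty:
  assumes "size C = size D"
  shows "perfect_matchings C D \<noteq> {}"
proof -
  obtain xs ys where "C = mset xs" "D = mset ys"
    by (metis ex_mset)
  then have "mset (zip xs ys) \<in> perfect_matchings C D"
    using assms by (simp add: perfect_matchings_def flip: mset_map)
  then show ?thesis by blast
qed

(* A request is a pair (pick-up, drop-off); a schedule lists the configurations in which the
   successive requests are picked up, i.e. those before the passenger's ride. *)

definition serves :: "'a set \<Rightarrow> nat \<Rightarrow> ('a \<times> 'a) list \<Rightarrow> 'a multiset list \<Rightarrow> bool" where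
  "serves M k rs Hs \<longleftrightarrow> list_all2 (\<lambda>(r, s) H. H \<in> multisets_of_size M k \<and> r \<in># H) rs Hs"

fun taxi_cost ::
  "('a \<Rightarrow> 'a \<Rightarrow> real) \<Rightarrow> 'a multiset \<Rightarrow> ('a \<times> 'a) list \<Rightarrow> 'a multiset list \<Rightarrow> real" where
  "taxi_cost d C ((r, s) # rs) (H # Hs) =
     matching_dist d C H + taxi_cost d (H - {#r#} + {#s#}) rs Hs"
| "taxi_cost d C _ _ = 0"

(* For k > 0 and C0 of size k in M, the infimum is attained: moving only the taxi that picks up
   the passenger loses nothing, and leaves finitely many schedules. *)
definition taxi_opt ::
  "'a set \<Rightarrow> ('a \<Rightarrow> 'a \<Rightarrow> real) \<Rightarrow> nat \<Rightarrow> 'a multiset \<Rightarrow> ('a \<times> 'a) list \<Rightarrow> real" where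
  "taxi_opt M d k C0 rs = Inf (taxi_cost d C0 rs ` {Hs. serves M k rs Hs})"

(* A deterministic online algorithm maps the requests revealed so far, the last one being the
   request to serve now, to the next configuration.  Its own earlier configurations are
   determined by the same data, so they need not be passed to it. *)

type_synonym 'a online_alg = "('a \<times> 'a) list \<Rightarrow> 'a multiset"

definition online_run :: "'a online_alg \<Rightarrow> ('a \<times> 'a) list \<Rightarrow> 'a multiset list" where
  "online_run A rs = map (\<lambda>t. A (take t rs)) [1..<Suc (length rs)]"

definition valid_online_alg :: "'a set \<Rightarrow> nat \<Rightarrow> 'a online_alg \<Rightarrow> bool" where
  "valid_online_alg M k A \<longleftrightarrow> (\<forall>rs\<in>lists (M \<times> M). serves M k rs (online_run A rs))"

definition competitive ::
  "'a set \<Rightarrow> ('a \<Rightarrow> 'a \<Rightarrow> real) \<Rightarrow> nat \<Rightarrow> 'a multiset \<Rightarrow> 'a online_alg \<Rightarrow> real \<Rightarrow> bool" where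
  "competitive M d k C0 A \<rho> \<longleftrightarrow>
     (\<exists>c. \<forall>rs\<in>lists (M \<times> M). taxi_cost d C0 rs (online_run A rs) \<le> \<rho> * taxi_opt M d k C0 rs + c)"

definition achievable_ratio :: "'a itself \<Rightarrow> nat \<Rightarrow> real \<Rightarrow> bool" where
  "achievable_ratio T k \<rho> \<longleftrightarrow>
     (\<exists>ALG. \<forall>(M :: 'a set) d C0. Metric_space M d \<and> C0 \<in> multisets_of_size M k \<longrightarrow>
        valid_online_alg M k (ALG M d C0) \<and> competitive M d k C0 (ALG M d C0) \<rho>)"

(* In achievable_ratio TYPE('a) k \<rho> the metric spaces have their points in 'a.  An existential
   quantifier over \<rho> in front of it would let \<rho> depend on 'a, and hence on the cardinality of
   the spaces, because HOL cannot quantify over types inside a formula.  The constant below is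
   a closed term without type parameters, so a statement about it for arbitrary 'a has one
   \<rho> for all metric spaces.  Nothing is lost: a ratio achievable on all countable metric spaces
   is achievable on every metric space, since adversary strategies that defeat all algorithms
   and all additive constants c in some space already do so in a countable subspace. *)

definition absolute_taxi_ratio :: "nat \<Rightarrow> real" where
  "absolute_taxi_ratio k = (SOME \<rho>. achievable_ratio TYPE(nat) k \<rho>)"

end

(* Serving a request (r, s) leaves one taxi at s, so a configuration is the last drop-off point
   together with an unordered pair of parked taxis.  A countable metric space embeds isometrically
   into the bounded functions on nat.  There the algorithm works with virtual taxis: while a marker
   travels along the segment from the new pick-up r to the previous drop-off s, the parked taxis
   x and y move so that a potential F (p, t) of the offline parked pair {p, t} pays for all moves.
   The point of the marker is that an offline taxi waiting at r is exchanged for one at s for free.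
   The parked taxis first wait, while a gauge g on pairs records a lower bound for the offline cost
   of having that pair parked.  When the accumulated cost E is no longer covered, all cheap pairs
   share an almost common point z: of any three cheap pairs, suitable members are close to each
   other.  Then x is moved to z and a second phase tests for a budget l whether the offline algorithm
   keeps a taxi near z; the taxi y chases the other one and, when the requests are near z, moves
   towards all points of a ball around z at once, which is possible by hyperconvexity.  The real
   taxis follow lazily along an optimal matching.

   The step from countable to arbitrary spaces is determinacy of an open game: either the online
   player can avoid losing for some additive constant n, or for every n the adversary wins, and then
   already does so within a countable subspace closed under its winning strategies. *)
theory Submission
  imports Defs
begin

text \<open>Seen from the two parked taxis, a request offers a free ride from the new pick-up r to
  the previous drop-off s: a parked taxi at r may accept it, while declining costs the offline
  algorithm d(r, s). Whoever accepts the whole ride accepts each piece of it, and the prices of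
  declining add up along a geodesic. Hence a ride may be cut into short pieces, and potentials need
  only local estimates. Offline pairs that decline are charged 10^14 per unit of length, so crude
  Lipschitz bounds suffice for them. The obstacle is the pairs that accept: the offline algorithm
  pays nothing, so a drop of the potential must finance the online moves. While waiting the term
  with E provides this drop, in the star phase the falling budget l. The constants are far from
  optimal; they only have to be separated widely enough. The constant
  \<open>absolute_taxi_ratio 3\<close> is a choice about which nothing is known except that it is
  achievable over nat. The transfer to other spaces is therefore carried out for an arbitrary ratio
  \<rho> and not just for 10^14.\<close>

section \<open>Matchings\<close>

lemma matching_dist_le:
  assumes "N \<in> perfect_matchings C D"
  shows "matching_dist d C D \<le> (\<Sum>(x, y)\<in>#N. d x y)"
  unfolding matching_dist_def using assms finite_perfect_matchings by (intro Min_le) auto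

lemma matching_dist_attained:
  assumes "size C = size D"
  obtains N where "N \<in> perfect_matchings C D" "matching_dist d C D = (\<Sum>(x, y)\<in>#N. d x y)"
proof -
  have "matching_dist d C D \<in> (\<lambda>N. \<Sum>(x, y)\<in>#N. d x y) ` perfect_matchings C D"
    unfolding matching_dist_def
    using assms finite_perfect_matchings perfect_matchings_nonempty by (intro Min_in) auto
  then show ?thesis using that by auto
qed

text \<open>Matchings are unordered multisets of pairs. Writing one along a fixed enumeration of its
  left side makes two optimal matchings composable, which gives the triangle inequality by induction
  on lists.\<close>

lemma matching_along_list:
  assumes "image_mset fst N = mset xs"
  shows "\<exists>ys. length ys = length xs \<and> N = mset (zip xs ys)"
  using assms
proof (induction xs arbitrary: N)
  case Nil
  then show ?case by auto
next
  case (Cons a xs)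
  from Cons.prems have "a \<in># image_mset fst N" by simp
  then obtain e where e: "e \<in># N" "fst e = a" by auto
  then obtain N' where N': "N = add_mset e N'" by (meson multi_member_split)
  with Cons.prems e have "image_mset fst N' = mset xs" by simp
  from Cons.IH[OF this] obtain ys where ys: "length ys = length xs" "N' = mset (zip xs ys)" by auto
  show ?case
    by (rule exI[of _ "snd e # ys"]) (use ys N' e in auto)
qed

lemma zip_in_perfect_matchings:
  assumes "length xs = length ys"
  shows "mset (zip xs ys) \<in> perfect_matchings (mset xs) (mset ys)"
  using assms by (simp add: perfect_matchings_def flip: mset_map)

lemma matching_dist_le_zip:
  assumes "length xs = length ys"
  shows "matching_dist d (mset xs) (mset ys) \<le> (\<Sum>(x, y)\<leftarrow>zip xs ys. d x y)"
  using matching_dist_le[OF zip_in_perfect_matchings[OF assms], of d]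
  by (simp add: sum_mset_sum_list flip: mset_map)

lemma matching_dist_attained_zip:
  assumes "size D = length xs"
  obtains ys where "length ys = length xs" "mset ys = D"
    "matching_dist d (mset xs) D = (\<Sum>(x, y)\<leftarrow>zip xs ys. d x y)"
proof -
  obtain N where N: "N \<in> perfect_matchings (mset xs) D"
    "matching_dist d (mset xs) D = (\<Sum>(x, y)\<in>#N. d x y)"
    using matching_dist_attained[of "mset xs" D d] assms by auto
  from N(1) have N12: "image_mset fst N = mset xs" "image_mset snd N = D"
    by (auto simp: perfect_matchings_def)
  from matching_along_list[OF N12(1)] obtain ys where
    ys: "length ys = length xs" "N = mset (zip xs ys)" by auto
  show ?thesis
  proof (rule that[of ys])
    show "mset ys = D" using N12(2) ys by (simp flip: mset_map)
    show "matching_dist d (mset xs) D = (\<Sum>(x, y)\<leftarrow>zip xs ys. d x y)"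
      using N(2) ys by (simp add: sum_mset_sum_list flip: mset_map)
  qed (use ys in auto)
qed

lemma matching_dist_add:
  assumes "size C = size D"
  shows "matching_dist d (add_mset a C) (add_mset b D) \<le> d a b + matching_dist d C D"
proof -
  obtain N where N: "N \<in> perfect_matchings C D" "matching_dist d C D = (\<Sum>(x, y)\<in>#N. d x y)"
    using matching_dist_attained[OF assms, of d] by blast
  then have "add_mset (a, b) N \<in> perfect_matchings (add_mset a C) (add_mset b D)"
    by (simp add: perfect_matchings_def)
  from matching_dist_le[OF this, of d] N(2) show ?thesis by simp
qed

text \<open>Deleting the edge at r from an optimal matching leaves a matching of the rest. This
  singles out the taxi that drives to a pick-up, online as well as offline.\<close>

lemma matching_dist_remove:
  assumes "size C = size D" "r \<in># D"
  shows "\<exists>x\<in>#C. d x r + matching_dist d (C - {#x#}) (D - {#r#}) \<le> matching_dist d C D"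
proof -
  obtain N where N: "N \<in> perfect_matchings C D" "matching_dist d C D = (\<Sum>(x, y)\<in>#N. d x y)"
    using matching_dist_attained[OF assms(1), of d] by blast
  from N(1) have N12: "image_mset fst N = C" "image_mset snd N = D"
    by (auto simp: perfect_matchings_def)
  from assms(2) N12(2) obtain e where e: "e \<in># N" "snd e = r" by auto
  then obtain N' where N': "N = add_mset e N'" by (meson multi_member_split)
  have "N' \<in> perfect_matchings (C - {#fst e#}) (D - {#r#})"
    using N12 N' e by (auto simp: perfect_matchings_def)
  from matching_dist_le[OF this, of d] N(2) N' e
  have "d (fst e) r + matching_dist d (C - {#fst e#}) (D - {#r#}) \<le> matching_dist d C D"
    by (cases e) auto
  moreover have "fst e \<in># C" using N12 N' by auto
  ultimately show ?thesis by blast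
qed

lemma matching_dist_nonneg:
  assumes "size C = size D" "\<And>x y. x \<in># C \<Longrightarrow> y \<in># D \<Longrightarrow> 0 \<le> d x y"
  shows "0 \<le> matching_dist d C D"
proof -
  obtain N where N: "N \<in> perfect_matchings C D" "matching_dist d C D = (\<Sum>(x, y)\<in>#N. d x y)"
    using matching_dist_attained[OF assms(1), of d] by blast
  have "0 \<le> d (fst e) (snd e)" if "e \<in># N" for e
    using N(1) that assms(2) by (force simp: perfect_matchings_def)
  then have "0 \<le> (\<Sum>(x, y)\<in>#N. d x y)"
    by (induction N) (auto simp: case_prod_beta)
  then show ?thesis using N(2) by simp
qed

lemma sum_list_zip_triangle:
  fixes d :: "'a \<Rightarrow> 'a \<Rightarrow> real"
  assumes "length xs = length ys" "length ys = length zs"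
    and "\<And>x y z. x \<in> set xs \<Longrightarrow> y \<in> set ys \<Longrightarrow> z \<in> set zs \<Longrightarrow> d x z \<le> d x y + d y z"
  shows "(\<Sum>(x, z)\<leftarrow>zip xs zs. d x z) \<le> (\<Sum>(x, y)\<leftarrow>zip xs ys. d x y) + (\<Sum>(y, z)\<leftarrow>zip ys zs. d y z)"
  using assms
proof (induction xs ys zs rule: list_induct3)
  case (Cons x xs y ys z zs)
  have "(\<Sum>(x, z)\<leftarrow>zip xs zs. d x z) \<le> (\<Sum>(x, y)\<leftarrow>zip xs ys. d x y) + (\<Sum>(y, z)\<leftarrow>zip ys zs. d y z)"
    by (rule Cons.IH) (use Cons.prems in auto)
  moreover have "d x z \<le> d x y + d y z" using Cons.prems by auto
  ultimately show ?case by simp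
qed auto

lemma matching_dist_triangle:
  assumes "size C = size D" "size D = size E"
    and "\<And>x y z. x \<in># C \<Longrightarrow> y \<in># D \<Longrightarrow> z \<in># E \<Longrightarrow> d x z \<le> d x y + d y z"
  shows "matching_dist d C E \<le> matching_dist d C D + matching_dist d D E"
proof -
  obtain xs where xs: "C = mset xs" by (metis ex_mset)
  have lD: "size D = length xs" using assms(1) xs by simp
  obtain ys where ys: "length ys = length xs" "mset ys = D"
    "matching_dist d (mset xs) D = (\<Sum>(x, y)\<leftarrow>zip xs ys. d x y)"
    using matching_dist_attained_zip[OF lD, of d] by blast
  have lE: "size E = length ys" using assms(2) lD ys(1) by simp
  obtain zs where zs: "length zs = length ys" "mset zs = E"
    "matching_dist d (mset ys) E = (\<Sum>(x, y)\<leftarrow>zip ys zs. d x y)"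
    using matching_dist_attained_zip[OF lE, of d] by blast
  have "matching_dist d C E \<le> (\<Sum>(x, z)\<leftarrow>zip xs zs. d x z)"
    using matching_dist_le_zip[of xs zs d] xs ys(1) zs(1,2) by simp
  also have "\<dots> \<le> (\<Sum>(x, y)\<leftarrow>zip xs ys. d x y) + (\<Sum>(y, z)\<leftarrow>zip ys zs. d y z)"
    by (rule sum_list_zip_triangle) (use assms(3) xs ys zs in auto)
  finally show ?thesis using ys zs xs by simp
qed

lemma matching_dist_zero:
  assumes "\<And>x. x \<in># C \<Longrightarrow> d x x = 0" "\<And>x y. x \<in># C \<Longrightarrow> y \<in># C \<Longrightarrow> 0 \<le> d x y"
  shows "matching_dist d C C = 0"
proof -
  obtain xs where xs: "C = mset xs" by (metis ex_mset)
  have "matching_dist d C C \<le> (\<Sum>(x, y)\<leftarrow>zip xs xs. d x y)"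
    using matching_dist_le_zip[of xs xs d] xs by simp
  also have "\<dots> = 0"
    using assms(1) unfolding xs by (induction xs) auto
  finally have 1: "matching_dist d C C \<le> 0" .
  show ?thesis using 1 matching_dist_nonneg[of C C d] assms(2) by force
qed

text \<open>If an optimal matching sends some x to p and leaves the other copy of p to serve a
  further point, the triangle inequality through p allows x to serve that point directly. In terms
  of matchings this is why a ride is free.\<close>

lemma matching_dist_cancel:
  assumes "size C = size D" "d p p = 0"
    and "\<And>x y z. x \<in># add_mset p C \<Longrightarrow> y \<in># add_mset p C \<Longrightarrow> z \<in># D \<Longrightarrow> d x z \<le> d x y + d y z"
    and "\<And>x. x \<in># C \<Longrightarrow> d x x = 0" and "\<And>x. x \<in># C \<Longrightarrow> d x p \<ge> 0"
    and "\<And>x y. x \<in># C \<Longrightarrow> y \<in># C \<Longrightarrow> 0 \<le> d x y"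
  shows "matching_dist d (add_mset p C) (add_mset p D) = matching_dist d C D"
proof (rule antisym)
  show "matching_dist d (add_mset p C) (add_mset p D) \<le> matching_dist d C D"
    using matching_dist_add[OF assms(1), of d p p] assms(2) by simp
  have "\<exists>x\<in>#add_mset p C. d x p + matching_dist d (add_mset p C - {#x#}) (add_mset p D - {#p#})
      \<le> matching_dist d (add_mset p C) (add_mset p D)"
    using assms(1) by (intro matching_dist_remove) auto
  then obtain x where x: "x \<in># add_mset p C"
    "d x p + matching_dist d (add_mset p C - {#x#}) D \<le> matching_dist d (add_mset p C) (add_mset p D)"
    unfolding add_mset_remove_trivial by blast
  show "matching_dist d C D \<le> matching_dist d (add_mset p C) (add_mset p D)"
  proof (cases "x = p")
    case True
    then show ?thesis using x(2) assms(2) by simp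
  next
    case False
    then obtain C' where C': "C = add_mset x C'" using x(1) by (metis insert_noteq_member multi_member_split)
    have "matching_dist d C D \<le> matching_dist d C (add_mset p C') + matching_dist d (add_mset p C') D"
      by (rule matching_dist_triangle) (use assms C' in auto)
    also have "matching_dist d C (add_mset p C') \<le> d x p + matching_dist d C' C'"
      unfolding C' by (rule matching_dist_add) simp
    also have "matching_dist d C' C' = 0"
      by (rule matching_dist_zero) (use assms C' in auto)
    finally show ?thesis using x(2) C' False by simp
  qed
qed

section \<open>Real inequalities for one piece of the ride, with the distances as free
  variables\<close>

section \<open>Arithmetic of the star potential\<close>

definition match2 :: "real \<Rightarrow> real \<Rightarrow> real \<Rightarrow> real \<Rightarrow> real" where
  "match2 xp xt yp yt = min (xp + yt) (xt + yp)"

definition excess :: "real \<Rightarrow> real \<Rightarrow> real \<Rightarrow> real" where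
  "excess xp xt l = max 0 (max xp xt - l / 125)"

text \<open>The arguments are the distances from the parked taxis x and y to the offline pair p, t:
  xp = d(x, p) and so on; l is the remaining budget of the phase with centre x.  The four terms
  anticipate the outcomes: nothing known, both offline taxis within l / 125 of x, and p or t
  staying at x.\<close>

definition star_min :: "real \<Rightarrow> real \<Rightarrow> real \<Rightarrow> real \<Rightarrow> real \<Rightarrow> real" where
  "star_min xp xt yp yt l = min (min (1000 * match2 xp xt yp yt + 15 * l)
     (1000 * match2 xp xt yp yt - l + 1000 * excess xp xt l))
     (min (50000 * xp + 1000 * yt - l) (50000 * xt + 1000 * yp - l))"

definition star_val :: "real \<Rightarrow> real \<Rightarrow> real \<Rightarrow> real \<Rightarrow> real \<Rightarrow> real" where
  "star_val xp xt yp yt l = max (128 * l) (star_min xp xt yp yt l)"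

lemma excess_ge: "0 \<le> excess xp xt l" "xp - l / 125 \<le> excess xp xt l" "xt - l / 125 \<le> excess xp xt l"
  by (auto simp: excess_def)

lemma excess_le:
  assumes "0 \<le> z" "xp - l / 125 \<le> z" "xt - l / 125 \<le> z"
  shows "excess xp xt l \<le> z"
  using assms by (auto simp: excess_def)

lemma excess_shift:
  assumes "xp' \<le> xp + e" "xt' \<le> xt + e" "l' \<le> l" "0 \<le> e"
  shows "excess xp' xt' l' \<le> excess xp xt l + e + (l / 125 - l' / 125)"
  using excess_ge(1)[of xp xt l] excess_ge(2)[of xp l xt] excess_ge(3)[of xt l xp] assms by (intro excess_le) linarith+

lemma match2_cases: "match2 xp xt yp yt = xp + yt \<or> match2 xp xt yp yt = xt + yp"
  and match2_le1: "match2 xp xt yp yt \<le> xp + yt" and match2_le2: "match2 xp xt yp yt \<le> xt + yp"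
  by (auto simp: match2_def)

lemma star_min_le:
  "star_min xp xt yp yt l \<le> 1000 * match2 xp xt yp yt + 15 * l"
  "star_min xp xt yp yt l \<le> 1000 * match2 xp xt yp yt - l + 1000 * excess xp xt l"
  "star_min xp xt yp yt l \<le> 50000 * xp + 1000 * yt - l"
  "star_min xp xt yp yt l \<le> 50000 * xt + 1000 * yp - l"
  unfolding star_min_def by (simp_all add: min.coboundedI1 min.coboundedI2)

lemma star_min_cases:
  obtains "star_min xp xt yp yt l = 1000 * match2 xp xt yp yt + 15 * l"
  | "star_min xp xt yp yt l = 1000 * match2 xp xt yp yt - l + 1000 * excess xp xt l"
  | "star_min xp xt yp yt l = 50000 * xp + 1000 * yt - l"
  | "star_min xp xt yp yt l = 50000 * xt + 1000 * yp - l"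
  unfolding star_min_def by (metis min_def)

text \<open>An alternative must drop by c only where it beats f0 and f0 exceeds the floor
  \<open>128 * l\<close>; elsewhere f0 or the floor bounds the potential and provides the drop.
  These exemptions permit moves that worsen an alternative which is not active. Here m may be any
  bound for the new minimum, for instance a single alternative.\<close>

lemma star_val_step:
  fixes m l l' c xp xt yp yt :: real
  defines "f0 \<equiv> 1000 * match2 xp xt yp yt + 15 * l"
    and "f2 \<equiv> 1000 * match2 xp xt yp yt - l + 1000 * excess xp xt l"
    and "fa \<equiv> 50000 * xp + 1000 * yt - l" and "fb \<equiv> 50000 * xt + 1000 * yp - l"
  assumes w: "w \<le> max (128 * l') m" and l: "128 * l' + c \<le> 128 * l"
    and f0: "m + c \<le> f0"
    and f2: "f2 < f0 \<Longrightarrow> f0 \<le> 128 * l \<or> m + c \<le> f2"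
    and fa: "fa < f0 \<Longrightarrow> f0 \<le> 128 * l \<or> m + c \<le> fa"
    and fb: "fb < f0 \<Longrightarrow> fb < f2 \<Longrightarrow> f0 \<le> 128 * l \<or> m + c \<le> fb"
  shows "w + c \<le> star_val xp xt yp yt l"
proof -
  let ?M = "star_min xp xt yp yt l"
  have "m + c \<le> max (128 * l) ?M"
  proof (cases rule: star_min_cases[of xp xt yp yt l])
    case 1
    then show ?thesis using f0 unfolding f0_def by linarith
  next
    case 2
    then have "?M = f2" by (simp add: f2_def)
    then show ?thesis using f0 f2 by linarith
  next
    case 3
    then have "?M = fa" by (simp add: fa_def)
    then show ?thesis using f0 fa by linarith
  next
    case 4
    then have M: "?M = fb" by (simp add: fb_def)
    show ?thesis
    proof (cases "fb < f0")
      case True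
      then show ?thesis using fb f2 f0 M by linarith
    next
      case False
      then show ?thesis using M f0 by linarith
    qed
  qed
  then show ?thesis using w l unfolding star_val_def by linarith
qed

text \<open>Beating f0 leaves room for an excess below 16 * l / 1000 = 2 * l / 125, on top of the
  tolerated radius l / 125.\<close>

lemma star_val_f2_small:
  assumes "1000 * match2 xp xt yp yt - l + 1000 * excess xp xt l < 1000 * match2 xp xt yp yt + 15 * l"
  shows "xp \<le> 3 * l / 125" "xt \<le> 3 * l / 125"
proof -
  show "xp \<le> 3 * l / 125" "xt \<le> 3 * l / 125"
    using assms excess_ge(1)[of xp xt l] excess_ge(2)[of xp l xt] excess_ge(3)[of xt l xp] by linarith+
qed

text \<open>The matching costs at most (3 + 8 + 3) * l / 125, and 1000 * 14 / 125 + 15 = 127. This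
  is the origin of the floor 128: once y is close to the cluster, the falling floor alone
  pays.\<close>

lemma star_val_near:
  assumes "0 \<le> l" "xp \<le> 3 * l / 125" "xt \<le> 3 * l / 125" "yp \<le> 8 * l / 125 + xp"
  shows "1000 * match2 xp xt yp yt + 15 * l \<le> 128 * l"
  using assms match2_le2[of xp xt yp yt] by linarith

text \<open>The total 43 * b consists of b for the marker, 2 * b for x and 40 * b for y. The rate
  3003 suits f0, since 15 * 3003 exceeds 43 * 1000 + 43, and also the alternative with r at x, since
  50000 exceeds 40000 + 3003 + 43.\<close>

lemma star_val_in_move:
  assumes b: "0 \<le> b" "3003 * b \<le> l" "l' = l - 3003 * b"
    and nn: "0 \<le> xr" "0 \<le> xt" "0 \<le> yr" "0 \<le> yt"
    and x: "xq \<le> xr - b" "xt' \<le> xt + 2 * b" "xr \<le> l / 125"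
    and y: "yq \<le> yr + b" "yt' \<le> yt + 40 * b"
    and h: "xt \<le> 3 * l / 125 \<Longrightarrow> yr \<le> 8 * l / 125 + xr \<or> yq \<le> yr - 39 * b \<and> yt' \<le> yt - 40 * b"
  shows "star_val xq xt' yq yt' l' + 43 * b \<le> star_val xr xt yr yt l"
proof (rule star_val_step[where m = "star_min xq xt' yq yt' l'" and l' = l'])
  let ?m = "star_min xq xt' yq yt' l'"
  let ?f0 = "1000 * match2 xr xt yr yt + 15 * l"
  let ?f2 = "1000 * match2 xr xt yr yt - l + 1000 * excess xr xt l"
  have pm: "match2 xq xt' yq yt' \<le> match2 xr xt yr yt + 43 * b"
    using x y match2_le1[of xq xt' yq yt'] match2_le2[of xq xt' yq yt'] match2_cases[of xr xt yr yt] b by linarith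
  show "?m + 43 * b \<le> ?f0"
    using pm b star_min_le(1)[of xq xt' yq yt' l'] by linarith
  show "star_val xq xt' yq yt' l' \<le> max (128 * l') ?m" by (simp add: star_val_def)
  show "128 * l' + 43 * b \<le> 128 * l" using b by simp
  show "?f0 \<le> 128 * l \<or> ?m + 43 * b \<le> ?f2" if "?f2 < ?f0"
  proof -
    note s = star_val_f2_small[OF that]
    from h[OF s(2)] show ?thesis
    proof
      assume "yr \<le> 8 * l / 125 + xr"
      then show ?thesis using star_val_near[of l xr xt yr yt] s b by auto
    next
      assume y': "yq \<le> yr - 39 * b \<and> yt' \<le> yt - 40 * b"
      have pm2: "match2 xq xt' yq yt' \<le> match2 xr xt yr yt - 37 * b"
        using x y' match2_le1[of xq xt' yq yt'] match2_le2[of xq xt' yq yt'] match2_cases[of xr xt yr yt] b by linarith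
      \<comment> \<open>The smaller budget shrinks the tolerated radius by about 24 * b. With the 2
        * b from the motion of x, the 3003 * b from the term - l and the cost 43 * b, the loss stays
        below the 37000 * b gained by the matching.\<close>
      have "excess xq xt' l' \<le> excess xr xt l + 2 * b + (l / 125 - l' / 125)"
        using x b by (intro excess_shift) auto
      then show ?thesis using pm2 b star_min_le(2)[of xq xt' yq yt' l'] by linarith
    qed
  qed
  show "?f0 \<le> 128 * l \<or> ?m + 43 * b \<le> 50000 * xr + 1000 * yt - l"
    using x y b star_min_le(3)[of xq xt' yq yt' l'] by linarith
  show "?f0 \<le> 128 * l \<or> ?m + 43 * b \<le> 50000 * xt + 1000 * yr - l"
    if "50000 * xt + 1000 * yr - l < ?f0" "50000 * xt + 1000 * yr - l < ?f2"
  \<comment> \<open>Beating f0 forces 49000 * xt < 16 * l, so xt lies below l / 125. But then the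
    excess vanishes and f2 is at most fb. So the alternative with t at x is never the one to worry
    about while x heads for r.\<close>
  proof (cases "xt \<le> l / 125")
    case True
    then have "excess xr xt l = 0" using x(3) nn by (simp add: excess_def)
    then show ?thesis using that match2_le2[of xr xt yr yt] nn by linarith
  next
    case False
    then show ?thesis using that match2_le2[of xr xt yr yt] b by linarith
  qed
qed

text \<open>After 2 * b the taxi x has reached r and rides with the offline taxi that accepts, so
  its new distance to the ridden taxi is 0 whatever the length of the ride. The alternative with p
  at x alone then bounds the new potential.\<close>

lemma star_val_x_board:
  assumes b: "0 \<le> b" "3003 * b \<le> l" "l' = l - 3003 * b" "xr = 2 * b"
    and nn: "0 \<le> xr" "0 \<le> xt" "0 \<le> yr" "0 \<le> yt"
    and x: "xr \<le> l / 125" and tri: "yt \<le> xr + xt + yr"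
    and y: "yt' \<le> yt + 40 * b"
    and h: "xt \<le> 3 * l / 125 \<Longrightarrow> yr \<le> 8 * l / 125 + xr \<or> yt' \<le> yt - 40 * b"
  shows "star_val 0 xt' yq yt' l' + 43 * b \<le> star_val xr xt yr yt l"
proof (rule star_val_step[where m = "1000 * yt' - l'" and l' = l'])
  let ?m = "1000 * yt' - l'"
  let ?f0 = "1000 * match2 xr xt yr yt + 15 * l"
  let ?f2 = "1000 * match2 xr xt yr yt - l + 1000 * excess xr xt l"
  have pm: "yt \<le> match2 xr xt yr yt + xr" using match2_cases[of xr xt yr yt] tri nn by linarith
  show "star_val 0 xt' yq yt' l' \<le> max (128 * l') ?m"
    using star_min_le(3)[of 0 xt' yq yt' l'] by (simp add: star_val_def)
  show "?m + 43 * b \<le> ?f0" using pm y b by linarith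
  show "128 * l' + 43 * b \<le> 128 * l" using b by simp
  show "?f0 \<le> 128 * l \<or> ?m + 43 * b \<le> ?f2" if "?f2 < ?f0"
  proof -
    note s = star_val_f2_small[OF that]
    from h[OF s(2)] show ?thesis
    proof
      assume "yr \<le> 8 * l / 125 + xr"
      then show ?thesis using star_val_near[of l xr xt yr yt] s b by auto
    next
      assume y': "yt' \<le> yt - 40 * b"
      then show ?thesis using pm b excess_ge(1)[of xr xt l] by linarith
    qed
  qed
  show "?f0 \<le> 128 * l \<or> ?m + 43 * b \<le> 50000 * xr + 1000 * yt - l"
    using b y by linarith
  show "?f0 \<le> 128 * l \<or> ?m + 43 * b \<le> 50000 * xt + 1000 * yr - l"
    if "50000 * xt + 1000 * yr - l < ?f0" "50000 * xt + 1000 * yr - l < ?f2"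
  proof (cases "xt \<le> l / 125")
    case True
    then have "excess xr xt l = 0" using x True by (simp add: excess_def)
    then show ?thesis using that match2_le2[of xr xt yr yt] nn by linarith
  next
    case False
    then show ?thesis using that match2_le2[of xr xt yr yt] b by linarith
  qed
qed

text \<open>Here x stands still. From xr = 16 * l / 49000 onwards 50000 * xr - l is at least 1000 *
  xr + 15 * l, so the alternative with r at x no longer beats f0 and may get worse.\<close>

lemma star_val_out_move:
  assumes b: "0 \<le> b" "3003 * b \<le> l" "l' = l - 3003 * b"
    and nn: "0 \<le> xr" "0 \<le> xt" "0 \<le> yr" "0 \<le> yt"
    and x: "xq \<le> xr + b" "xr \<ge> 16 * l / 49000"
    and y: "yq \<le> yr + b" "yt' \<le> yt + 40 * b"
    and h: "yr \<le> 8 * l / 125 + xr \<and> xr \<le> 3 * l / 125 \<or>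
      yq \<le> yr - 39 * b \<and> (xt \<le> 3 * l / 125 \<and> xr \<le> 3 * l / 125 \<longrightarrow> yt' \<le> yt - 40 * b)"
  shows "star_val xq xt yq yt' l' + 43 * b \<le> star_val xr xt yr yt l"
proof (rule star_val_step[where m = "star_min xq xt yq yt' l'" and l' = l'])
  let ?m = "star_min xq xt yq yt' l'"
  let ?f0 = "1000 * match2 xr xt yr yt + 15 * l"
  let ?f2 = "1000 * match2 xr xt yr yt - l + 1000 * excess xr xt l"
  have pm: "match2 xq xt yq yt' \<le> match2 xr xt yr yt + 43 * b"
    using x y match2_le1[of xq xt yq yt'] match2_le2[of xq xt yq yt'] match2_cases[of xr xt yr yt] b by linarith
  show "?m + 43 * b \<le> ?f0"
    using pm b star_min_le(1)[of xq xt yq yt' l'] by linarith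
  show "star_val xq xt yq yt' l' \<le> max (128 * l') ?m" by (simp add: star_val_def)
  show "128 * l' + 43 * b \<le> 128 * l" using b by simp
  show "?f0 \<le> 128 * l \<or> ?m + 43 * b \<le> ?f2" if "?f2 < ?f0"
  proof -
    note s = star_val_f2_small[OF that]
    from h show ?thesis
    proof
      assume "yr \<le> 8 * l / 125 + xr \<and> xr \<le> 3 * l / 125"
      then show ?thesis using star_val_near[of l xr xt yr yt] s b by auto
    next
      assume "yq \<le> yr - 39 * b \<and> (xt \<le> 3 * l / 125 \<and> xr \<le> 3 * l / 125 \<longrightarrow> yt' \<le> yt - 40 * b)"
      then have y': "yq \<le> yr - 39 * b" "yt' \<le> yt - 40 * b" using s by auto
      have pm2: "match2 xq xt yq yt' \<le> match2 xr xt yr yt - 37 * b"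
        using x y' match2_le1[of xq xt yq yt'] match2_le2[of xq xt yq yt'] match2_cases[of xr xt yr yt] b by linarith
      have "excess xq xt l' \<le> excess xr xt l + 2 * b + (l / 125 - l' / 125)"
        using x b by (intro excess_shift) auto
      then show ?thesis using pm2 b star_min_le(2)[of xq xt yq yt' l'] by linarith
    qed
  qed
  show "?f0 \<le> 128 * l \<or> ?m + 43 * b \<le> 50000 * xr + 1000 * yt - l"
    if "50000 * xr + 1000 * yt - l < ?f0"
    using that x(2) match2_le1[of xr xt yr yt] by linarith
  show "?f0 \<le> 128 * l \<or> ?m + 43 * b \<le> 50000 * xt + 1000 * yr - l"
    if *: "50000 * xt + 1000 * yr - l < ?f0" "50000 * xt + 1000 * yr - l < ?f2"
    using h
  proof
    assume "yr \<le> 8 * l / 125 + xr \<and> xr \<le> 3 * l / 125"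
    then show ?thesis using star_val_near[of l xr xt yr yt] *(1) match2_le2[of xr xt yr yt] b by auto
  next
    assume "yq \<le> yr - 39 * b \<and> (xt \<le> 3 * l / 125 \<and> xr \<le> 3 * l / 125 \<longrightarrow> yt' \<le> yt - 40 * b)"
    then show ?thesis using b star_min_le(4)[of xq xt yq yt' l'] by linarith
  qed
qed

text \<open>Now y rides with the accepting offline taxi, which leaves only the distance from x to t.
  If xr is at least 3 * l / 125, the excess is at least 16 * l / 1000 and f2 cannot beat f0.\<close>

lemma star_val_y_board:
  assumes b: "0 \<le> b" "3003 * b \<le> l" "l' = l - 3003 * b" "yr = 40 * b"
    and nn: "0 \<le> xr" "0 \<le> xt" "0 \<le> yr" "0 \<le> yt"
    and x: "xr \<ge> 16 * l / 49000" "xr \<ge> 3 * l / 125 \<or> yr = 0" and tri: "xt \<le> xr + yr + yt"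
  shows "star_val xq xt 0 yt' l' + 43 * b \<le> star_val xr xt yr yt l"
proof (rule star_val_step[where m = "min (1000 * xt + 15 * l') (50000 * xt - l')"
      and l' = l'])
  let ?m = "min (1000 * xt + 15 * l') (50000 * xt - l')"
  let ?f0 = "1000 * match2 xr xt yr yt + 15 * l"
  let ?f2 = "1000 * match2 xr xt yr yt - l + 1000 * excess xr xt l"
  have pm: "xt \<le> match2 xr xt yr yt + yr" using match2_cases[of xr xt yr yt] tri nn by linarith
  show "star_val xq xt 0 yt' l' \<le> max (128 * l') ?m"
    using star_min_le(4)[of xq xt 0 yt' l'] star_min_le(1)[of xq xt 0 yt' l'] match2_le2[of xq xt 0 yt']
    unfolding star_val_def by linarith
  show "?m + 43 * b \<le> ?f0" using pm b by linarith
  show "128 * l' + 43 * b \<le> 128 * l" using b by simp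
  show "?f0 \<le> 128 * l \<or> ?m + 43 * b \<le> ?f2" if "?f2 < ?f0"
    using x(2)
  proof
    assume "3 * l / 125 \<le> xr"
    then show ?thesis using that b excess_ge(2)[of xr l xt] by linarith
  next
    assume "yr = 0"
    then show ?thesis using star_val_f2_small[OF that] match2_le2[of xr xt yr yt] b by linarith
  qed
  show "?f0 \<le> 128 * l \<or> ?m + 43 * b \<le> 50000 * xr + 1000 * yt - l"
    if "50000 * xr + 1000 * yt - l < ?f0"
    using that x(1) match2_le1[of xr xt yr yt] by linarith
  show "?f0 \<le> 128 * l \<or> ?m + 43 * b \<le> 50000 * xt + 1000 * yr - l"
    using b by linarith
qed

text \<open>A crude bound for pairs that decline a ride and for offline driving; both are charged
  10^14 per unit of length.\<close>

lemma star_val_change: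
  assumes "xp' \<le> xp + e" "xt' \<le> xt + e" "yp' \<le> yp + e" "yt' \<le> yt + e" "l' \<le> l" "0 \<le> e"
  shows "star_val xp' xt' yp' yt' l' \<le> star_val xp xt yp yt l + 60000 * e + 10 * l - 10 * l'"
proof -
  let ?M = "star_min xp xt yp yt l" and ?M' = "star_min xp' xt' yp' yt' l'"
  have pm: "match2 xp' xt' yp' yt' \<le> match2 xp xt yp yt + 2 * e"
    using assms match2_le1[of xp' xt' yp' yt'] match2_le2[of xp' xt' yp' yt'] match2_cases[of xp xt yp yt] by linarith
  have mx: "excess xp' xt' l' \<le> excess xp xt l + e + (l / 125 - l' / 125)"
    using assms by (intro excess_shift) auto
  note le = star_min_le[of xp' xt' yp' yt' l']
  have "?M' \<le> ?M + 60000 * e + 10 * l - 10 * l'"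
  proof (cases rule: star_min_cases[of xp xt yp yt l])
    case 1
    then show ?thesis using le(1) pm assms by linarith
  next
    case 2
    then show ?thesis using le(2) pm mx assms by linarith
  next
    case 3
    then show ?thesis using le(3) assms by linarith
  next
    case 4
    then show ?thesis using le(4) assms by linarith
  qed
  then show ?thesis unfolding star_val_def using assms by linarith
qed

section \<open>Virtual taxis in a hyperconvex space\<close>

type_synonym linf = "nat \<Rightarrow>\<^sub>C real"

abbreviation conf_dist :: "linf multiset \<Rightarrow> linf multiset \<Rightarrow> real" where
  "conf_dist \<equiv> matching_dist dist"

section \<open>Geometry of the space of bounded functions\<close>

lemma linf_dist_le: "\<bar>apply_bcontfun f i - apply_bcontfun g i\<bar> \<le> dist f g" for f g :: linf
  using dist_bounded[of f i g] by (simp add: dist_real_def)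

text \<open>The hypothesis says that the balls of radius dist y t - m around the points t of T meet
  pairwise; each also meets the ball of radius m around y. Balls are given by an interval in every
  coordinate, and pairwise intersecting intervals share a point, even if T is infinite.\<close>

lemma hyperconvex_progress:
  fixes y :: linf
  assumes m: "0 \<le> m" and T: "\<And>t u. t \<in> T \<Longrightarrow> u \<in> T \<Longrightarrow> dist t u + 2 * m \<le> dist y t + dist y u"
  shows "\<exists>y'. dist y y' \<le> m \<and> (\<forall>t\<in>T. dist y' t \<le> dist y t - m)"
proof (cases "T = {}")
  case True
  then show ?thesis using m by (intro exI[of _ y]) auto
next
  case False
  define s where "s i = (SUP t\<in>T. apply_bcontfun t i - dist y t + m)" for i
  \<comment> \<open>The largest left end point of all the intervals in coordinate i.\<close>
  define f where "f i = max (apply_bcontfun y i - m) (s i)" for i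
  have up: "apply_bcontfun t i - dist y t + m \<le> apply_bcontfun y i + m" for t i
    using linf_dist_le[of t i y] by (simp add: dist_commute)
  have bdd: "bdd_above ((\<lambda>t. apply_bcontfun t i - dist y t + m) ` T)" for i
    using up by (rule bdd_aboveI2)
  have lo: "apply_bcontfun t i - dist y t + m \<le> s i" if "t \<in> T" for t i
    unfolding s_def using bdd that by (intro cSUP_upper) auto
  have s_le: "s i \<le> apply_bcontfun y i + m" for i
    unfolding s_def using False up by (intro cSUP_least) auto
  have s_le2: "s i \<le> apply_bcontfun t i + dist y t - m" if "t \<in> T" for t i
    unfolding s_def
  proof (intro cSUP_least False)
    fix u assume "u \<in> T"
    then show "apply_bcontfun u i - dist y u + m \<le> apply_bcontfun t i + dist y t - m"
      using T[OF that, of u] linf_dist_le[of t i u] by linarith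
  qed
  have close: "\<bar>apply_bcontfun y i - f i\<bar> \<le> m" for i
    using s_le[of i] m unfolding f_def by auto
  have "f \<in> bcontfun"
  proof -
    obtain B where B: "\<bar>apply_bcontfun y i\<bar> \<le> B" for i
      using bounded_apply_bcontfun[of y] unfolding bounded_iff by auto
    have "bounded (range f)"
      unfolding bounded_iff
    proof (intro exI ballI)
      fix v assume "v \<in> range f"
      then obtain i where "v = f i" by auto
      then show "norm v \<le> B + m" using close[of i] B[of i] by auto
    qed
    then show ?thesis by (auto simp: bcontfun_def)
  qed
  then obtain y' where y': "f = apply_bcontfun y'" by (rule bcontfunE)
  have "dist y y' \<le> m"
    using close by (intro dist_bound) (simp add: y' dist_real_def)
  moreover have "dist y' t \<le> dist y t - m" if "t \<in> T" for t
  proof (rule dist_bound)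
    fix i
    have "apply_bcontfun y i - m \<le> apply_bcontfun t i + dist y t - m"
      using linf_dist_le[of y i t] by linarith
    then have "f i \<le> apply_bcontfun t i + dist y t - m" using s_le2[OF that, of i] by (simp add: f_def)
    moreover have "apply_bcontfun t i - dist y t + m \<le> f i" using lo[OF that, of i] by (simp add: f_def)
    ultimately show "dist (apply_bcontfun y' i) (apply_bcontfun t i) \<le> dist y t - m"
      by (simp add: y' dist_real_def abs_le_iff)
  qed
  ultimately show ?thesis by blast
qed

lemma segment_point:
  fixes r s :: linf
  assumes "0 \<le> b" "b \<le> dist r s"
  shows "\<exists>q. dist r q = b \<and> dist q s = dist r s - b"
proof (cases "r = s")
  case True
  then show ?thesis using assms by (intro exI[of _ r]) auto
next
  case False
  define t where "t = b / dist r s"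
  have t: "0 \<le> t" "t \<le> 1" using assms False by (auto simp: t_def)
  define q where "q = r + t *\<^sub>R (s - r)"
  have "dist r q = t * dist r s"
    using t by (simp add: q_def dist_norm norm_minus_commute)
  moreover have "q - s = (1 - t) *\<^sub>R (r - s)" by (simp add: q_def algebra_simps)
  then have "dist q s = (1 - t) * dist r s"
    using t by (simp add: dist_norm)
  ultimately show ?thesis using False by (intro exI[of _ q]) (simp add: t_def algebra_simps)
qed

text \<open>The point lies on the segment from y to x. If x moves to z and y to y', the distance
  from y' to any t is at most dist y t + dist x z and at most dist x t + dist y z, so it does not
  matter which of x and y was matched with t.\<close>

lemma midway_point:
  fixes x y z :: linf
  shows "\<exists>y'. dist y y' \<le> dist x z \<and> dist x y' \<le> dist y z"
proof -
  obtain q where q: "dist y q = min (dist x z) (dist x y)" "dist q x = dist y x - min (dist x z) (dist x y)"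
    using segment_point[of "min (dist x z) (dist x y)" y x] by (auto simp: dist_commute)
  then show ?thesis
    using dist_triangle[of x y z] by (intro exI[of _ q]) (auto simp: dist_commute min_def)
qed

text \<open>The marker moves from r to q.  An offline taxi parked at r may be replaced by one at q for
  free; otherwise the offline algorithm has to pay for the distance travelled by the marker.\<close>

definition pot_ok :: "(linf \<Rightarrow> linf \<Rightarrow> real) \<Rightarrow> (linf \<Rightarrow> linf \<Rightarrow> real) \<Rightarrow> linf \<Rightarrow> linf \<Rightarrow> real \<Rightarrow> bool" where
  "pot_ok F F' r q c \<longleftrightarrow> (\<forall>t. F' q t + c \<le> F r t) \<and> (\<forall>p t. F' p t + c \<le> F p t + 10^14 * dist r q)"

text \<open>For u = x, v = y and w = r the right-hand matching costs nothing, so this bounds the cost of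
  moving the taxis q, x, y to r, x', y'.  Unlike that special case it composes along the
  segment.\<close>

definition server_move :: "linf \<Rightarrow> linf \<Rightarrow> linf \<Rightarrow> linf \<Rightarrow> linf \<Rightarrow> linf \<Rightarrow> real \<Rightarrow> bool" where
  "server_move x y r x' y' q c \<longleftrightarrow>
     (\<forall>u v w. conf_dist {#q, u, v#} {#w, x', y'#} \<le> conf_dist {#r, u, v#} {#w, x, y#} + c)"

definition alg_step where
  "alg_step x y F r x' y' F' q \<longleftrightarrow> (\<exists>c. pot_ok F F' r q c \<and> server_move x y r x' y' q c)"

section \<open>Composition and cost of moves of the virtual taxis\<close>

lemma server_move_trans:
  assumes "server_move x y r x' y' q c" "server_move x' y' q x'' y'' s c'"
  shows "server_move x y r x'' y'' s (c + c')"
  unfolding server_move_def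
proof (intro allI)
  fix u v w
  from assms have "conf_dist {#s, u, v#} {#w, x'', y''#} \<le> conf_dist {#q, u, v#} {#w, x', y'#} + c'"
    "conf_dist {#q, u, v#} {#w, x', y'#} \<le> conf_dist {#r, u, v#} {#w, x, y#} + c"
    unfolding server_move_def by blast+
  then show "conf_dist {#s, u, v#} {#w, x'', y''#} \<le> conf_dist {#r, u, v#} {#w, x, y#} + (c + c')" by linarith
qed

lemma server_move_mono: "server_move x y r x' y' q c \<Longrightarrow> c \<le> c' \<Longrightarrow> server_move x y r x' y' q c'"
  unfolding server_move_def by (meson add_left_mono order_trans)

lemma server_move_swap1: "server_move x y r x' y' q c \<Longrightarrow> server_move y x r x' y' q c"
  unfolding server_move_def by (simp add: add_mset_commute)

lemma server_move_swap2: "server_move x y r x' y' q c \<Longrightarrow> server_move x y r y' x' q c"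
  unfolding server_move_def by (simp add: add_mset_commute)

lemma conf_dist_add: "size C = size D \<Longrightarrow> conf_dist (add_mset a C) (add_mset b D) \<le> dist a b + conf_dist C D"
  by (rule matching_dist_add)

lemma conf_dist_refl: "conf_dist C C = 0"
  by (rule matching_dist_zero) auto

lemma conf_dist_cancel: "size C = size D \<Longrightarrow> conf_dist (add_mset p C) (add_mset p D) = conf_dist C D"
  by (rule matching_dist_cancel) (auto intro: dist_triangle)

lemma conf_dist_triangle: "size C = size D \<Longrightarrow> size D = size E \<Longrightarrow> conf_dist C E \<le> conf_dist C D + conf_dist D E"
  by (rule matching_dist_triangle) (auto intro: dist_triangle)

lemma conf_dist_three: "conf_dist {#a, b, c#} {#a', b', c'#} \<le> dist a a' + dist b b' + dist c c'"
proof -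
  have "conf_dist {#c#} {#c'#} \<le> dist c c'" using conf_dist_add[of "{#}" "{#}" c c'] by (simp add: conf_dist_refl)
  moreover have "conf_dist {#b, c#} {#b', c'#} \<le> dist b b' + conf_dist {#c#} {#c'#}" by (rule conf_dist_add) simp
  moreover have "conf_dist {#a, b, c#} {#a', b', c'#} \<le> dist a a' + conf_dist {#b, c#} {#b', c'#}" by (rule conf_dist_add) simp
  ultimately show ?thesis by linarith
qed

lemma server_move_miss: "server_move x y r x' y' q (dist r q + dist x x' + dist y y')"
  unfolding server_move_def
proof (intro allI)
  fix u v w
  have "conf_dist {#q, u, v#} {#w, x', y'#} \<le> conf_dist {#q, u, v#} {#r, u, v#} + conf_dist {#r, u, v#} {#w, x', y'#}"
    by (rule conf_dist_triangle) auto
  moreover have "conf_dist {#r, u, v#} {#w, x', y'#} \<le> conf_dist {#r, u, v#} {#w, x, y#} + conf_dist {#w, x, y#} {#w, x', y'#}"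
    by (rule conf_dist_triangle) auto
  ultimately show "conf_dist {#q, u, v#} {#w, x', y'#} \<le> conf_dist {#r, u, v#} {#w, x, y#} + (dist r q + dist x x' + dist y y')"
    using conf_dist_three[of q u v r u v] conf_dist_three[of w x y w x' y'] by (simp add: dist_commute)
qed

text \<open>The common points r and q cancel from the two matchings, so a virtual taxi standing at
  the marker rides along for nothing.\<close>

lemma server_move_hit: "server_move r y r q y q 0"
  unfolding server_move_def
proof (intro allI)
  fix u v w
  have "conf_dist {#q, u, v#} {#w, q, y#} = conf_dist {#u, v#} {#w, y#}"
    using conf_dist_cancel[of "{#u, v#}" "{#w, y#}" q] by (simp add: add_mset_commute)
  also have "\<dots> = conf_dist {#r, u, v#} {#w, r, y#}"
    using conf_dist_cancel[of "{#u, v#}" "{#w, y#}" r] by (simp add: add_mset_commute)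
  finally show "conf_dist {#q, u, v#} {#w, q, y#} \<le> conf_dist {#r, u, v#} {#w, r, y#} + 0" by simp
qed

lemma server_move_board: "server_move x y r s y' s (dist x r + dist y y')"
  using server_move_trans[OF server_move_miss[of x y r r y' r] server_move_hit[of r y' s]] by simp

lemma alg_step_refl: "alg_step x y F r x y F r"
  unfolding alg_step_def pot_ok_def server_move_def by (intro exI[of _ 0]) auto

text \<open>A pair that accepts passes through a pair containing q. For a pair that declines, the
  charges of the two pieces add up to the charge of the whole ride because q lies on a geodesic from
  r to s.\<close>

lemma alg_step_trans:
  assumes "alg_step x y F r x' y' F' q" "alg_step x' y' F' q x'' y'' F'' s" "dist r q + dist q s = dist r s"
  shows "alg_step x y F r x'' y'' F'' s"
proof -
  from assms(1) obtain c where c: "pot_ok F F' r q c" "server_move x y r x' y' q c" unfolding alg_step_def by blast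
  from assms(2) obtain c' where c': "pot_ok F' F'' q s c'" "server_move x' y' q x'' y'' s c'" unfolding alg_step_def by blast
  have 1: "F'' s t + (c + c') \<le> F r t" for t
    using c(1) c'(1) unfolding pot_ok_def by (smt (verit))
  have 2: "F'' p t + (c + c') \<le> F p t + 10^14 * dist r s" for p t
  proof -
    have "F'' p t + c' \<le> F' p t + 10^14 * dist q s" "F' p t + c \<le> F p t + 10^14 * dist r q"
      using c(1) c'(1) unfolding pot_ok_def by blast+
    then show ?thesis unfolding assms(3)[symmetric] by (simp add: algebra_simps)
  qed
  have "pot_ok F F'' r s (c + c')" using 1 2 unfolding pot_ok_def by blast
  with server_move_trans[OF c(2) c'(2)] show ?thesis unfolding alg_step_def by blast
qed

lemma alg_step_swap1: "alg_step x y F r x' y' F' q \<Longrightarrow> alg_step y x F r x' y' F' q"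
  unfolding alg_step_def using server_move_swap1 by blast

section \<open>The star phase\<close>

definition pair_match :: "linf \<Rightarrow> linf \<Rightarrow> linf \<Rightarrow> linf \<Rightarrow> real" where
  "pair_match x y p t = match2 (dist x p) (dist x t) (dist y p) (dist y t)"

definition star_pot :: "linf \<Rightarrow> linf \<Rightarrow> real \<Rightarrow> linf \<Rightarrow> linf \<Rightarrow> real" where
  "star_pot x y l p t = star_val (dist x p) (dist x t) (dist y p) (dist y t) l"

lemma star_pot_change:
  assumes "dist x x' \<le> e" "dist y y' \<le> e" "l' \<le> l"
  shows "star_pot x' y' l' p t \<le> star_pot x y l p t + 60000 * e + 10 * l - 10 * l'"
proof -
  have "0 \<le> e" using assms(1) zero_le_dist order_trans by blast
  moreover have "dist x' z \<le> dist x z + e" "dist y' z \<le> dist y z + e" for z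
    using assms(1,2) dist_triangle[of x' z x] dist_triangle[of y' z y] by (simp_all add: dist_commute)
  ultimately show ?thesis unfolding star_pot_def using assms(3) by (intro star_val_change)
qed

text \<open>An exhausted budget leaves a potential that has forgotten the centre and treats both
  taxis alike. It is the neutral state from which the next phase starts.\<close>

lemma star_pot_zero: "star_pot x y 0 p t = 1000 * pair_match x y p t"
proof -
  let ?m = "match2 (dist x p) (dist x t) (dist y p) (dist y t)"
  let ?M = "star_min (dist x p) (dist x t) (dist y p) (dist y t) 0"
  have "?m \<ge> 0" by (simp add: match2_def)
  moreover have "?M \<le> 1000 * ?m" using star_min_le(1)[of "dist x p" "dist x t" "dist y p" "dist y t" 0] by simp
  moreover have "1000 * ?m \<le> ?M"
    using star_min_cases[of "dist x p" "dist x t" "dist y p" "dist y t" 0]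
      excess_ge(1)[of "dist x p" "dist x t" 0] match2_le1[of "dist x p" "dist x t" "dist y p" "dist y t"]
      match2_le2[of "dist x p" "dist x t" "dist y p" "dist y t"] zero_le_dist[of x p] zero_le_dist[of x t]
    by (smt (verit))
  ultimately show ?thesis unfolding star_pot_def star_val_def pair_match_def by simp
qed

text \<open>The summand a allows for a ride: a boarding taxi is displaced by its approach plus the
  length of the ride. This affects only the crude estimate for declining pairs, where it is covered
  by 10^14 * dist r q.\<close>

lemma star_step:
  assumes x': "dist x x' \<le> 2 * b + a" and y': "dist y y' \<le> 40 * b + a" and b: "0 \<le> b" "b \<le> a" "l' = l - 3003 * b"
    and a: "a \<le> dist r q"
    and own: "\<And>t. star_pot x' y' l' q t + 43 * b \<le> star_pot x y l r t"
    and move: "server_move x y r x' y' q (43 * b)"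
  shows "alg_step x y (star_pot x y l) r x' y' (star_pot x' y' l') q"
proof -
  have "star_pot x' y' l' p t + 43 * b \<le> star_pot x y l p t + 10^14 * dist r q" for p t
    using star_pot_change[of x x' "41 * a" y y' l' l p t] x' y' a b by simp
  then show ?thesis unfolding alg_step_def pot_ok_def using own move by blast
qed

text \<open>Far from the centre, the second server approaches the whole cluster around the centre at
  once; this is where hyperconvexity enters.\<close>

lemma cluster_progress:
  fixes x y r :: linf
  assumes b: "0 \<le> b" "3003 * b \<le> l" and r: "dist x r \<le> 3 * l / 125"
  obtains y' where "dist y y' \<le> 40 * b" "dist y' r \<le> dist y r"
    "dist y r \<le> 8 * l / 125 + dist x r \<or>
     dist y' r \<le> dist y r - 40 * b \<and> (\<forall>t. dist x t \<le> 3 * l / 125 \<longrightarrow> dist y' t \<le> dist y t - 40 * b)"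
proof (cases "dist x y \<le> 8 * l / 125")
  case True
  then show ?thesis using that[of y] b dist_triangle[of y r x] by (auto simp: dist_commute)
next
  case False
  have "\<exists>y'. dist y y' \<le> 40 * b \<and> (\<forall>t\<in>{t. dist x t \<le> 3 * l / 125}. dist y' t \<le> dist y t - 40 * b)"
  proof (rule hyperconvex_progress)
    fix t u assume "t \<in> {t. dist x t \<le> 3 * l / 125}" "u \<in> {t. dist x t \<le> 3 * l / 125}"
    then have "dist x t \<le> 3 * l / 125" "dist x u \<le> 3 * l / 125" by auto
    moreover have "dist t u \<le> dist x t + dist x u" using dist_triangle[of t u x] by (simp add: dist_commute)
    moreover have "dist x y \<le> dist x t + dist y t" "dist x y \<le> dist x u + dist y u"
      using dist_triangle[of x y t] dist_triangle[of x y u] by (simp_all add: dist_commute)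
    ultimately show "dist t u + 2 * (40 * b) \<le> dist y t + dist y u" using False b by argo
  qed (use b in auto)
  then obtain y' where y': "dist y y' \<le> 40 * b" "\<And>t. dist x t \<le> 3 * l / 125 \<Longrightarrow> dist y' t \<le> dist y t - 40 * b"
    by auto
  then show ?thesis using that[of y'] y'(2)[OF r] b by auto
qed

lemma star_phase:
  fixes x y r s :: linf
  assumes l: "0 \<le> l"
  shows "\<exists>x' y' l' q. 0 \<le> l' \<and> (l' = 0 \<or> q = s) \<and> dist r q + dist q s = dist r s \<and>
    alg_step x y (star_pot x y l) r x' y' (star_pot x' y' l') q"
proof -
  define a where "a = dist r s"
  have tri: "dist y t \<le> dist x r + dist x t + dist y r" "dist x t \<le> dist x r + dist y r + dist y t" for t
    using dist_triangle[of y t r] dist_triangle[of r t x] dist_triangle[of x t r] dist_triangle[of r t y]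
    by (simp_all add: dist_commute)
  \<comment> \<open>The piece is the whole ride, unless the budget, spent at rate 3003, runs out
    earlier.\<close>
  define b where "b = min a (l / 3003)"
  have b: "0 \<le> b" "3003 * b \<le> l" "b \<le> a" "b = a \<or> 3003 * b = l"
    using l by (auto simp: b_def a_def min_def)
  obtain q where q: "dist r q = b" "dist q s = a - b"
    using segment_point[of b r s] b unfolding a_def by blast
  have qs: "3003 * b = l \<or> q = s" using b(4) q(2) by auto
  have qr: "dist r q + dist q s = dist r s" using q by (simp add: a_def)
  have tq: "dist z q \<le> dist z r + b" for z using dist_triangle[of z q r] q by simp
  have finish: ?thesis if "alg_step x y (star_pot x y l) r x' y' (star_pot x' y' (l - 3003 * b)) q" for x' y'
    using that qs b qr by (intro exI[of _ x'] exI[of _ y'] exI[of _ "l - 3003 * b"] exI[of _ q]) auto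
  have ride: ?thesis
    if "0 \<le> e" "e \<le> b" "alg_step x y (star_pot x y l) r x' y' (star_pot x' y' (l - 3003 * e)) s" for x' y' e
    using that b by (intro exI[of _ x'] exI[of _ y'] exI[of _ "l - 3003 * e"] exI[of _ s]) auto
  \<comment> \<open>Up to 16 * l / 49000 an offline taxi at r can be the one kept at the centre, so
    x goes for r. Up to 3 * l / 125 the point r can belong to the cluster, so y approaches the
    cluster including r. Beyond that y runs straight to r.\<close>
  consider (board_x) "dist x r \<le> 16 * l / 49000" "dist x r \<le> 2 * b"
    | (near) "dist x r \<le> 16 * l / 49000" "2 * b \<le> dist x r"
    | (mid) "16 * l / 49000 \<le> dist x r" "dist x r \<le> 3 * l / 125"
    | (board_y) "3 * l / 125 \<le> dist x r" "dist y r \<le> 40 * b"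
    | (far) "3 * l / 125 < dist x r" "40 * b \<le> dist y r"
    by linarith
  then show ?thesis
  proof cases
    case board_x
    \<comment> \<open>Boarding settles the rest of the ride, so the budget is charged only for the
      time that x needs at speed 2.\<close>
    define e where "e = dist x r / 2"
    have e: "0 \<le> e" "e \<le> b" "3003 * e \<le> l" "dist x r = 2 * e" using board_x b by (auto simp: e_def)
    have xr: "dist x r \<le> 3 * l / 125" using board_x l by simp
    obtain y' where y': "dist y y' \<le> 40 * e" "dist y' r \<le> dist y r"
      "dist y r \<le> 8 * l / 125 + dist x r \<or>
       dist y' r \<le> dist y r - 40 * e \<and> (\<forall>t. dist x t \<le> 3 * l / 125 \<longrightarrow> dist y' t \<le> dist y t - 40 * e)"
      using cluster_progress[OF e(1,3) xr] by blast
    have "alg_step x y (star_pot x y l) r s y' (star_pot s y' (l - 3003 * e)) s"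
    proof (rule star_step[where b = e and a = a])
      show "dist x s \<le> 2 * e + a" using dist_triangle[of x s r] e by (simp add: a_def)
      show "dist y y' \<le> 40 * e + a" using y'(1) by (simp add: a_def add_increasing2)
      show "server_move x y r s y' s (43 * e)"
        by (rule server_move_mono[OF server_move_board]) (use e y'(1) in linarith)
      fix t
      have yt: "dist y' t \<le> dist y t + 40 * e"
        using y'(1) dist_triangle[of y' t y] by (simp add: dist_commute)
      have "star_val 0 (dist s t) (dist y' s) (dist y' t) (l - 3003 * e) + 43 * e
          \<le> star_val (dist x r) (dist x t) (dist y r) (dist y t) l"
      proof (rule star_val_x_board)
        show "dist x r \<le> l / 125" using board_x l by simp
        show "dist y r \<le> 8 * l / 125 + dist x r \<or> dist y' t \<le> dist y t - 40 * e" if "dist x t \<le> 3 * l / 125"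
          using y'(3) that by blast
      qed (use e tri yt in auto)
      then show "star_pot s y' (l - 3003 * e) s t + 43 * e \<le> star_pot x y l r t"
        by (simp add: star_pot_def)
    qed (use e b a_def in auto)
    then show ?thesis using ride e by blast
  next
    case near
    obtain x' where x': "dist x x' = 2 * b" "dist x' r = dist x r - 2 * b"
      using segment_point[of "2 * b" x r] near b by auto
    have xr: "dist x r \<le> 3 * l / 125" using near l by simp
    obtain y' where y': "dist y y' \<le> 40 * b" "dist y' r \<le> dist y r"
      "dist y r \<le> 8 * l / 125 + dist x r \<or>
       dist y' r \<le> dist y r - 40 * b \<and> (\<forall>t. dist x t \<le> 3 * l / 125 \<longrightarrow> dist y' t \<le> dist y t - 40 * b)"
      using cluster_progress[OF b(1,2) xr] by blast
    have "alg_step x y (star_pot x y l) r x' y' (star_pot x' y' (l - 3003 * b)) q"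
    proof (rule star_step[where b = b and a = b])
      show "server_move x y r x' y' q (43 * b)"
        by (rule server_move_mono[OF server_move_miss]) (use q x' y'(1) in linarith)
      fix t
      have yt: "dist y' t \<le> dist y t + 40 * b"
        using y'(1) dist_triangle[of y' t y] by (simp add: dist_commute)
      have xt: "dist x' t \<le> dist x t + 2 * b"
        using x'(1) dist_triangle[of x' t x] by (simp add: dist_commute)
      show "star_pot x' y' (l - 3003 * b) q t + 43 * b \<le> star_pot x y l r t"
        unfolding star_pot_def
      proof (rule star_val_in_move)
        show "dist y r \<le> 8 * l / 125 + dist x r \<or> dist y' q \<le> dist y r - 39 * b \<and> dist y' t \<le> dist y t - 40 * b"
          if "dist x t \<le> 3 * l / 125"
          using y'(3) that tq[of y'] by auto
        show "dist y' q \<le> dist y r + b" using y'(2) tq[of y'] by simp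
      qed (use b yt xt x' tq[of x'] near l in auto)
    qed (use b x' y'(1) q in auto)
    then show ?thesis using finish by blast
  next
    case mid
    obtain y' where y': "dist y y' \<le> 40 * b" "dist y' r \<le> dist y r"
      "dist y r \<le> 8 * l / 125 + dist x r \<or>
       dist y' r \<le> dist y r - 40 * b \<and> (\<forall>t. dist x t \<le> 3 * l / 125 \<longrightarrow> dist y' t \<le> dist y t - 40 * b)"
      using cluster_progress[OF b(1,2) mid(2)] by blast
    have "alg_step x y (star_pot x y l) r x y' (star_pot x y' (l - 3003 * b)) q"
    proof (rule star_step[where b = b and a = b])
      show "server_move x y r x y' q (43 * b)"
        by (rule server_move_mono[OF server_move_miss]) (use q y'(1) b in simp)
      fix t
      have yt: "dist y' t \<le> dist y t + 40 * b"
        using y'(1) dist_triangle[of y' t y] by (simp add: dist_commute)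
      show "star_pot x y' (l - 3003 * b) q t + 43 * b \<le> star_pot x y l r t"
        unfolding star_pot_def
      proof (rule star_val_out_move)
        show "dist y r \<le> 8 * l / 125 + dist x r \<and> dist x r \<le> 3 * l / 125 \<or>
          dist y' q \<le> dist y r - 39 * b \<and>
          (dist x t \<le> 3 * l / 125 \<and> dist x r \<le> 3 * l / 125 \<longrightarrow> dist y' t \<le> dist y t - 40 * b)"
          using y'(3) mid tq[of y'] by auto
        show "dist y' q \<le> dist y r + b" using y'(2) tq[of y'] by simp
      qed (use b yt tq[of x] mid in auto)
    qed (use b y'(1) q in auto)
    then show ?thesis using finish by blast
  next
    case board_y
    define e where "e = dist y r / 40"
    have e: "0 \<le> e" "e \<le> b" "3003 * e \<le> l" "dist y r = 40 * e" using board_y b by (auto simp: e_def)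
    have "alg_step x y (star_pot x y l) r x s (star_pot x s (l - 3003 * e)) s"
    proof (rule star_step[where b = e and a = a])
      show "dist y s \<le> 40 * e + a" using dist_triangle[of y s r] e by (simp add: a_def)
      have "server_move y x r s x s (43 * e)"
        by (rule server_move_mono[OF server_move_board]) (use e in simp)
      then show "server_move x y r x s s (43 * e)" using server_move_swap1 server_move_swap2 by blast
      fix t
      have "star_val (dist x s) (dist x t) 0 (dist s t) (l - 3003 * e) + 43 * e
          \<le> star_val (dist x r) (dist x t) (dist y r) (dist y t) l"
        by (rule star_val_y_board) (use e tri board_y l in auto)
      then show "star_pot x s (l - 3003 * e) s t + 43 * e \<le> star_pot x y l r t"
        by (simp add: star_pot_def)
    qed (use e b a_def in auto)
    then show ?thesis using ride e by blast
  next
    case far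
    obtain y' where y': "dist y y' = 40 * b" "dist y' r = dist y r - 40 * b"
      using segment_point[of "40 * b" y r] far b by auto
    have "alg_step x y (star_pot x y l) r x y' (star_pot x y' (l - 3003 * b)) q"
    proof (rule star_step[where b = b and a = b])
      show "server_move x y r x y' q (43 * b)"
        by (rule server_move_mono[OF server_move_miss]) (use q y'(1) b in simp)
      fix t
      have yt: "dist y' t \<le> dist y t + 40 * b"
        using y'(1) dist_triangle[of y' t y] by (simp add: dist_commute)
      show "star_pot x y' (l - 3003 * b) q t + 43 * b \<le> star_pot x y l r t"
        unfolding star_pot_def
        by (rule star_val_out_move) (use b yt tq[of x] tq[of y'] y' far l in auto)
    qed (use b y'(1) q in auto)
    then show ?thesis using finish by blast
  qed
qed

section \<open>The waiting phase\<close>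

lemma pair_match_commute: "pair_match x y t p = pair_match x y p t"
  by (simp add: pair_match_def match2_def min.commute)

lemma pair_match_swap: "pair_match y x p t = pair_match x y p t"
  by (simp add: pair_match_def match2_def min.commute add.commute)

lemma pair_match_nonneg: "0 \<le> pair_match x y p t"
  by (simp add: pair_match_def match2_def)

lemma pair_match_le: "pair_match x y p t \<le> dist x p + dist y t" "pair_match x y p t \<le> dist x t + dist y p"
  by (simp_all add: pair_match_def match2_def)

lemma pair_match_cases: "pair_match x y p t = dist x p + dist y t \<or> pair_match x y p t = dist x t + dist y p"
  by (auto simp: pair_match_def match2_def)

lemma pair_match_lipschitz: "pair_match x y p' t \<le> pair_match x y p t + dist p p'"
  using pair_match_le[of x y p' t] pair_match_cases[of x y p t] dist_triangle[of x p' p] dist_triangle[of y p' p]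
  by linarith

lemma pair_match_move: "pair_match x' y p t \<le> pair_match x y p t + dist x x'"
  using pair_match_le[of x' y p t] pair_match_cases[of x y p t] dist_triangle[of x' p x] dist_triangle[of x' t x]
    dist_commute[of x' x] by linarith

lemma pair_match_own: "pair_match r y r t = dist y t"
  using pair_match_le(1)[of r y r t] pair_match_cases[of r y r t] dist_triangle[of y t r] dist_self[of r] by linarith

lemma pair_match_own_le: "dist y t \<le> pair_match q y p t + dist p q"
  using pair_match_cases[of q y p t] dist_triangle[of y t q] dist_triangle[of y q p] zero_le_dist[of q p] zero_le_dist[of p q]
  by linarith

definition pair_lip :: "(linf \<Rightarrow> linf \<Rightarrow> real) \<Rightarrow> bool" where
  "pair_lip g \<longleftrightarrow> (\<forall>p t. 0 \<le> g p t) \<and> (\<forall>p t. g p t = g t p) \<and> (\<forall>p p' t. g p' t \<le> g p t + dist p p')"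

text \<open>The offline algorithm cannot keep three pairs cheap at total cost below E unless they
  almost share a point; this prevents two candidates for the centre of the star.\<close>

definition clustered :: "(linf \<Rightarrow> linf \<Rightarrow> real) \<Rightarrow> real \<Rightarrow> bool" where
  "clustered g E \<longleftrightarrow> (\<forall>p1 t1 p2 t2 p3 t3. let S = g p1 t1 + g p2 t2 + g p3 t3 in
     E \<le> S \<or> (\<exists>u\<in>{p1, t1}. \<exists>v\<in>{p2, t2}. \<exists>w\<in>{p3, t3}. dist u v \<le> S \<and> dist v w \<le> S \<and> dist u w \<le> S))"

text \<open>After the marker has moved from r to q, the pair p, t was either parked before at the extra
  cost dist r q, or arises from a pair containing r by the free exchange.\<close>

definition shift_gauge :: "(linf \<Rightarrow> linf \<Rightarrow> real) \<Rightarrow> linf \<Rightarrow> linf \<Rightarrow> linf \<Rightarrow> linf \<Rightarrow> real" where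
  "shift_gauge g r q p t = min (g p t + dist r q) (min (g r t + dist p q) (g r p + dist t q))"

text \<open>For k = 1000 this keeps \<open>wait_pot\<close> nonnegative. The weaker k = 500 still
  holds after one further piece and leaves a reserve of about 499000 * E for the change of
  phase.\<close>

definition balanced :: "real \<Rightarrow> linf \<Rightarrow> linf \<Rightarrow> (linf \<Rightarrow> linf \<Rightarrow> real) \<Rightarrow> real \<Rightarrow> bool" where
  "balanced k x y g E \<longleftrightarrow> (\<forall>p t. k * E \<le> pair_match x y p t + 2 * 10^8 * g p t)"

text \<open>1001 = 1000 + 1: for a pair that accepts, a missed piece raises the matching cost and
  the online cost by at most its length each, while the gauge does not grow.\<close>

definition wait_pot :: "linf \<Rightarrow> linf \<Rightarrow> (linf \<Rightarrow> linf \<Rightarrow> real) \<Rightarrow> real \<Rightarrow> linf \<Rightarrow> linf \<Rightarrow> real" where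
  "wait_pot x y g E p t = 1000 * pair_match x y p t + 10^12 * g p t - 1001 * E"

section \<open>Invariants of the gauge along a ride\<close>

lemma pair_lip_nonneg: "pair_lip g \<Longrightarrow> 0 \<le> g p t"
  and pair_lip_commute: "pair_lip g \<Longrightarrow> g t p = g p t"
  and pair_lip_lipschitz: "pair_lip g \<Longrightarrow> g p' t \<le> g p t + dist p p'"
  by (simp_all add: pair_lip_def)

lemma pair_lip_zero: "pair_lip (\<lambda>p t. 0)" and clustered_zero: "clustered (\<lambda>p t. 0) 0"
  by (simp_all add: pair_lip_def clustered_def)

lemma shift_gauge_cases:
  obtains (stay) "shift_gauge g r q p t = g p t + dist r q"
  | (left) "shift_gauge g r q p t = g r t + dist p q"
  | (right) "shift_gauge g r q p t = g r p + dist t q"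
  unfolding shift_gauge_def min_def by (metis (full_types))

lemma shift_gauge_le: "shift_gauge g r q p t \<le> g p t + dist r q" "shift_gauge g r q p t \<le> g r t + dist p q"
  "shift_gauge g r q p t \<le> g r p + dist t q"
  by (simp_all add: shift_gauge_def)

lemma pair_lip_shift_gauge:
  assumes "pair_lip g"
  shows "pair_lip (shift_gauge g r q)"
  unfolding pair_lip_def
proof (intro conjI allI)
  fix p p' t
  show "0 \<le> shift_gauge g r q p t" using pair_lip_nonneg[OF assms] by (simp add: shift_gauge_def)
  show "shift_gauge g r q p t = shift_gauge g r q t p"
    using pair_lip_commute[OF assms, of p t] by (simp add: shift_gauge_def min.commute)
  show "shift_gauge g r q p' t \<le> shift_gauge g r q p t + dist p p'"
  proof (cases rule: shift_gauge_cases[of g r q p t])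
    case stay
    then show ?thesis using shift_gauge_le(1)[of g r q p' t] pair_lip_lipschitz[OF assms, of p' t p] by linarith
  next
    case left
    then show ?thesis using shift_gauge_le(2)[of g r q p' t] dist_triangle[of p' q p] by (simp add: dist_commute)
  next
    case right
    have "g r p' \<le> g r p + dist p p'" using pair_lip_lipschitz[OF assms, of p' r p] pair_lip_commute[OF assms] by simp
    then show ?thesis using right shift_gauge_le(3)[of g r q p' t] by linarith
  qed
qed

text \<open>P is the pair after the free exchange and P' the pair before it, in which r stands for a
  member of P within e of q.\<close>

definition rerouted :: "linf \<Rightarrow> linf \<Rightarrow> linf set \<Rightarrow> linf set \<Rightarrow> real \<Rightarrow> bool" where
  "rerouted r q P P' e \<longleftrightarrow> (\<exists>z\<in>P. dist z q \<le> e) \<and> (\<forall>u\<in>P'. \<exists>u'\<in>P. u' = u \<or> u = r \<and> dist u' q \<le> e)"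

lemma shift_gauge_origin:
  assumes "pair_lip g"
  obtains p' t' e where "shift_gauge g r q p t = g p' t' + e" "0 \<le> e"
    "e = dist r q \<and> {p', t'} \<subseteq> {p, t} \<or> rerouted r q {p, t} {p', t'} e"
proof (cases rule: shift_gauge_cases[of g r q p t])
  case stay
  then show ?thesis using that[of p t "dist r q"] by auto
next
  case left
  then show ?thesis using that[of r t "dist p q"] by (auto simp: rerouted_def)
next
  case right
  then show ?thesis using that[of r p "dist t q"] by (auto simp: rerouted_def)
qed

lemma rerouted_point:
  assumes "c \<and> P' \<subseteq> P \<or> rerouted r q P P' e" "u \<in> P'"
  shows "\<exists>u'\<in>P. u' = u \<or> u = r \<and> dist u' q \<le> e \<and> \<not> (c \<and> P' \<subseteq> P)"
  using assms unfolding rerouted_def by blast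

text \<open>Two rerouted points meet at q within e1 + e2. If only one is rerouted, the detour from r
  to q has length dist r q, which is the price already paid by a pair that stayed.\<close>

lemma rerouted_dist:
  fixes u v u' v' r q :: linf
  assumes u': "u' = u \<or> u = r \<and> dist u' q \<le> e1 \<and> \<not> st1"
    and v': "v' = v \<or> v = r \<and> dist v' q \<le> e2 \<and> \<not> st2"
    and uv: "dist u v \<le> S" and st: "st1 \<or> st2 \<or> st3"
    and e: "st1 \<Longrightarrow> e1 = dist r q" "st2 \<Longrightarrow> e2 = dist r q" "st3 \<Longrightarrow> e3 = dist r q"
    and pos: "0 \<le> e1" "0 \<le> e2" "0 \<le> e3"
  shows "dist u' v' \<le> S + e1 + e2 + e3"
proof -
  have tri: "dist u' v' \<le> dist u' q + dist v' q" "dist u v' \<le> dist u r + dist r q + dist v' q"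
    "dist u' v \<le> dist u' q + dist r q + dist r v"
    using dist_triangle[of u' v' q] dist_triangle[of u v' r] dist_triangle[of r v' q]
      dist_triangle[of u' v r] dist_triangle[of u' r q] dist_commute[of q v'] dist_commute[of q r] by linarith+
  have S: "0 \<le> S" using uv zero_le_dist order_trans by blast
  consider "u' = u" "v' = v" | "u' = u" "v = r" "dist v' q \<le> e2" "\<not> st2"
    | "u = r" "dist u' q \<le> e1" "\<not> st1" "v' = v"
    | "dist u' q \<le> e1" "dist v' q \<le> e2" using u' v' by blast
  then show ?thesis
  proof cases
    case 1
    then show ?thesis using uv pos by simp
  next
    case 2
    then have "dist r q \<le> e1 + e3" using st e pos by fastforce
    then show ?thesis using 2 tri(2) uv by simp
  next
    case 3
    then have "dist r q \<le> e2 + e3" using st e pos by fastforce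
    then show ?thesis using 3 tri(3) uv by simp
  next
    case 4
    then show ?thesis using tri(1) S pos by linarith
  qed
qed

text \<open>If some pair stayed, e1 + e2 + e3 is at least dist r q, which covers both the growth of
  E and every detour from r to q. If all three pairs took the free exchange, each has a member near
  q, and these members form the new cluster.\<close>

lemma clustered_shift_gauge:
  assumes g: "pair_lip g" and cl: "clustered g E"
  shows "clustered (shift_gauge g r q) (E + dist r q)"
  unfolding clustered_def Let_def
proof (intro allI)
  fix p1 t1 p2 t2 p3 t3
  obtain a1 b1 e1 where 1: "shift_gauge g r q p1 t1 = g a1 b1 + e1" "0 \<le> e1"
    "e1 = dist r q \<and> {a1, b1} \<subseteq> {p1, t1} \<or> rerouted r q {p1, t1} {a1, b1} e1"
    by (rule shift_gauge_origin[OF g])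
  obtain a2 b2 e2 where 2: "shift_gauge g r q p2 t2 = g a2 b2 + e2" "0 \<le> e2"
    "e2 = dist r q \<and> {a2, b2} \<subseteq> {p2, t2} \<or> rerouted r q {p2, t2} {a2, b2} e2"
    by (rule shift_gauge_origin[OF g])
  obtain a3 b3 e3 where 3: "shift_gauge g r q p3 t3 = g a3 b3 + e3" "0 \<le> e3"
    "e3 = dist r q \<and> {a3, b3} \<subseteq> {p3, t3} \<or> rerouted r q {p3, t3} {a3, b3} e3"
    by (rule shift_gauge_origin[OF g])
  define st1 where "st1 \<longleftrightarrow> e1 = dist r q \<and> {a1, b1} \<subseteq> {p1, t1}"
  define st2 where "st2 \<longleftrightarrow> e2 = dist r q \<and> {a2, b2} \<subseteq> {p2, t2}"
  define st3 where "st3 \<longleftrightarrow> e3 = dist r q \<and> {a3, b3} \<subseteq> {p3, t3}"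
  have st: "st1 \<Longrightarrow> e1 = dist r q" "st2 \<Longrightarrow> e2 = dist r q" "st3 \<Longrightarrow> e3 = dist r q"
    by (simp_all add: st1_def st2_def st3_def)
  define S where "S = g a1 b1 + g a2 b2 + g a3 b3"
  define S' where "S' = shift_gauge g r q p1 t1 + shift_gauge g r q p2 t2 + shift_gauge g r q p3 t3"
  have SS: "S' = S + e1 + e2 + e3" using 1 2 3 by (simp add: S_def S'_def)
  have S0: "0 \<le> S" using pair_lip_nonneg[OF g] by (simp add: S_def)
  have "E + dist r q \<le> S' \<or>
    (\<exists>u\<in>{p1, t1}. \<exists>v\<in>{p2, t2}. \<exists>w\<in>{p3, t3}. dist u v \<le> S' \<and> dist v w \<le> S' \<and> dist u w \<le> S')"
  proof (cases "st1 \<or> st2 \<or> st3")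
    case False
    then obtain u v w where uvw: "u \<in> {p1, t1}" "v \<in> {p2, t2}" "w \<in> {p3, t3}"
      "dist u q \<le> e1" "dist v q \<le> e2" "dist w q \<le> e3"
      using 1(3) 2(3) 3(3) unfolding rerouted_def st1_def st2_def st3_def by meson
    then have "dist u v \<le> S'" "dist v w \<le> S'" "dist u w \<le> S'"
      using dist_triangle2[of u v q] dist_triangle2[of v w q] dist_triangle2[of u w q] S0 1(2) 2(2) 3(2)
      unfolding SS by linarith+
    then show ?thesis using uvw(1-3) by blast
  next
    case True
    have "E \<le> S \<or> (\<exists>u\<in>{a1, b1}. \<exists>v\<in>{a2, b2}. \<exists>w\<in>{a3, b3}. dist u v \<le> S \<and> dist v w \<le> S \<and> dist u w \<le> S)"
      using cl unfolding clustered_def Let_def S_def by blast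
    then consider "E \<le> S"
      | u v w where "u \<in> {a1, b1}" "v \<in> {a2, b2}" "w \<in> {a3, b3}" "dist u v \<le> S" "dist v w \<le> S" "dist u w \<le> S"
      by (metis (no_types))
    then show ?thesis
    proof cases
      case E: 1
      have "dist r q \<le> e1 + e2 + e3" using True st 1(2) 2(2) 3(2) by fastforce
      then show ?thesis using E unfolding SS by simp
    next
      case uvw: (2 u v w)
      obtain u' where u': "u' \<in> {p1, t1}" "u' = u \<or> u = r \<and> dist u' q \<le> e1 \<and> \<not> st1"
        using rerouted_point[OF 1(3) uvw(1)] unfolding st1_def by blast
      obtain v' where v': "v' \<in> {p2, t2}" "v' = v \<or> v = r \<and> dist v' q \<le> e2 \<and> \<not> st2"
        using rerouted_point[OF 2(3) uvw(2)] unfolding st2_def by blast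
      obtain w' where w': "w' \<in> {p3, t3}" "w' = w \<or> w = r \<and> dist w' q \<le> e3 \<and> \<not> st3"
        using rerouted_point[OF 3(3) uvw(3)] unfolding st3_def by blast
      have perm: "st2 \<or> st3 \<or> st1" "st1 \<or> st3 \<or> st2" using True by auto
      have "dist u' v' \<le> S'"
        unfolding SS by (rule rerouted_dist[OF u'(2) v'(2) uvw(4) True st 1(2) 2(2) 3(2)])
      moreover have "dist v' w' \<le> S + e2 + e3 + e1"
        by (rule rerouted_dist[OF v'(2) w'(2) uvw(5) perm(1) st(2,3,1) 2(2) 3(2) 1(2)])
      moreover have "dist u' w' \<le> S + e1 + e3 + e2"
        by (rule rerouted_dist[OF u'(2) w'(2) uvw(6) perm(2) st(1,3,2) 1(2) 3(2) 2(2)])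
      moreover have "S + e2 + e3 + e1 = S'" "S + e1 + e3 + e2 = S'" unfolding SS by simp_all
      ultimately have "dist u' v' \<le> S' \<and> dist v' w' \<le> S' \<and> dist u' w' \<le> S'" by simp
      then show ?thesis using u'(1) v'(1) w'(1) by blast
    qed
  qed
  then show "E + dist r q \<le> shift_gauge g r q p1 t1 + shift_gauge g r q p2 t2 + shift_gauge g r q p3 t3 \<or>
    (\<exists>u\<in>{p1, t1}. \<exists>v\<in>{p2, t2}. \<exists>w\<in>{p3, t3}.
      dist u v \<le> shift_gauge g r q p1 t1 + shift_gauge g r q p2 t2 + shift_gauge g r q p3 t3 \<and>
      dist v w \<le> shift_gauge g r q p1 t1 + shift_gauge g r q p2 t2 + shift_gauge g r q p3 t3 \<and>
      dist u w \<le> shift_gauge g r q p1 t1 + shift_gauge g r q p2 t2 + shift_gauge g r q p3 t3)"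
    unfolding S'_def .
qed

lemma clustered_mono: "clustered g E \<Longrightarrow> E' \<le> E \<Longrightarrow> clustered g E'"
  unfolding clustered_def Let_def by (meson order_trans)

text \<open>Since the piece has length at most E / 4, the left side grows to at most 625 * E,
  whereas rerouting a pair takes only dist r q off the old lower bound 1000 * E.\<close>

lemma balanced_stay:
  assumes E: "0 \<le> E" and bal: "balanced 1000 x y g E" and a: "4 * dist r q \<le> E"
  shows "balanced 500 x y (shift_gauge g r q) (E + dist r q)"
  unfolding balanced_def
proof (intro allI)
  fix p t
  have bal': "1000 * E \<le> pair_match x y p t + 2 * 10^8 * g p t" for p t using bal unfolding balanced_def by blast
  show "500 * (E + dist r q) \<le> pair_match x y p t + 2 * 10^8 * shift_gauge g r q p t"
  proof (cases rule: shift_gauge_cases[of g r q p t])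
    case stay
    then show ?thesis using bal'[of p t] E a zero_le_dist[of r q] by (simp del: zero_le_dist add: algebra_simps)
  next
    case left
    have "pair_match x y r t \<le> pair_match x y p t + dist p q + dist r q"
      using pair_match_lipschitz[of x y r t p] dist_triangle[of p r q] by (simp add: dist_commute)
    then show ?thesis unfolding left using bal'[of r t] E a zero_le_dist[of p q] by (simp del: zero_le_dist add: algebra_simps)
  next
    case right
    have "pair_match x y r p \<le> pair_match x y t p + dist t q + dist r q"
      using pair_match_lipschitz[of x y r p t] dist_triangle[of t r q] by (simp add: dist_commute)
    then show ?thesis unfolding right using bal'[of r p] E a zero_le_dist[of t q] pair_match_commute[of x y t p] by (simp del: zero_le_dist add: algebra_simps)
  qed
qed

text \<open>E is unchanged because riding along costs nothing. For an exchanged pair the matching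
  with the riding taxi reduces, on both sides of the ride, to the distance from y to the other
  member, up to a term paid by the gauge.\<close>

lemma balanced_hit:
  assumes bal: "balanced 1000 r y g E"
  shows "balanced 1000 q y (shift_gauge g r q) E"
  unfolding balanced_def
proof (intro allI)
  fix p t
  have bal': "1000 * E \<le> pair_match r y p t + 2 * 10^8 * g p t" for p t using bal unfolding balanced_def by blast
  show "1000 * E \<le> pair_match q y p t + 2 * 10^8 * shift_gauge g r q p t"
  proof (cases rule: shift_gauge_cases[of g r q p t])
    case stay
    have "pair_match r y p t \<le> pair_match q y p t + dist r q" using pair_match_move[of r y p t q] by (simp add: dist_commute)
    then show ?thesis unfolding stay using bal'[of p t] zero_le_dist[of r q] by (simp del: zero_le_dist add: algebra_simps)
  next
    case left
    then show ?thesis unfolding left using bal'[of r t] pair_match_own[of r y t] pair_match_own_le[of y t q p] zero_le_dist[of p q]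
      by (simp del: zero_le_dist add: algebra_simps)
  next
    case right
    then show ?thesis unfolding right
      using bal'[of r p] pair_match_own[of r y p] pair_match_own_le[of y p q t] zero_le_dist[of t q] pair_match_commute[of q y t p]
      by (simp del: zero_le_dist add: algebra_simps)
  qed
qed

lemma wait_step_miss:
  "alg_step x y (wait_pot x y g E) r x y (wait_pot x y (shift_gauge g r q) (E + dist r q)) q"
proof -
  have "wait_pot x y (shift_gauge g r q) (E + dist r q) q t + dist r q \<le> wait_pot x y g E r t" for t
    using shift_gauge_le(2)[of g r q q t] pair_match_lipschitz[of x y q t r]
    by (simp add: wait_pot_def algebra_simps)
  moreover have "wait_pot x y (shift_gauge g r q) (E + dist r q) p t + dist r q \<le> wait_pot x y g E p t + 10^14 * dist r q" for p t
    using shift_gauge_le(1)[of g r q p t] zero_le_dist[of r q] by (simp del: zero_le_dist add: wait_pot_def)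
  moreover have "server_move x y r x y q (dist r q)" using server_move_miss[of x y r x y q] by simp
  ultimately show ?thesis unfolding alg_step_def pot_ok_def by blast
qed

lemma wait_step_hit:
  "alg_step r y (wait_pot r y g E) r q y (wait_pot q y (shift_gauge g r q) E) q"
proof -
  have "wait_pot q y (shift_gauge g r q) E q t + 0 \<le> wait_pot r y g E r t" for t
    using shift_gauge_le(2)[of g r q q t] pair_match_own[of r y t] pair_match_own[of q y t] by (simp add: wait_pot_def)
  moreover have "wait_pot q y (shift_gauge g r q) E p t + 0 \<le> wait_pot r y g E p t + 10^14 * dist r q" for p t
    using shift_gauge_le(1)[of g r q p t] pair_match_move[of q y p t r] dist_commute[of q r] zero_le_dist[of r q]
    by (simp del: zero_le_dist add: wait_pot_def)
  ultimately show ?thesis unfolding alg_step_def pot_ok_def using server_move_hit by blast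
qed

lemma wait_pot_reserve:
  assumes "pair_lip g" "balanced 500 x y g E"
  shows "500000 * E - 1001 * E \<le> wait_pot x y g E p t"
proof -
  have "500 * E \<le> pair_match x y p t + 2 * 10^8 * g p t" using assms(2) unfolding balanced_def by blast
  then show ?thesis using pair_lip_nonneg[OF assms(1), of p t] by (simp add: wait_pot_def)
qed

text \<open>If a cheap pair avoided z and another one avoided z0, then these two and the violating pair
  z, z0 would contradict clusteredness.\<close>

lemma violated_star:
  assumes g: "pair_lip g" and cl: "clustered g E" and E: "0 < E" and viol: "\<not> balanced 1000 x y g E"
  obtains z z0 where "pair_match x y z z0 \<le> 1000 * E"
    "\<And>p t. 200000 * g p t < E \<Longrightarrow> 200000 * dist p z \<le> 3 * E \<or> 200000 * dist t z \<le> 3 * E"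
proof -
  obtain z z0 where zo: "pair_match x y z z0 + 2 * 10^8 * g z z0 < 1000 * E"
    using viol unfolding balanced_def by (auto simp: not_le)
  \<comment> \<open>200000 = 2 * 10^8 / 1000: a violated balance exposes a pair that is almost free
    for the offline algorithm, compared with E.\<close>
  have small: "200000 * g z z0 < E" "pair_match x y z z0 \<le> 1000 * E"
    using zo pair_match_nonneg[of x y z z0] pair_lip_nonneg[OF g, of z z0] by auto
  define star where "star c \<longleftrightarrow>
    (\<forall>p t. 200000 * g p t < E \<longrightarrow> 200000 * dist p c \<le> 3 * E \<or> 200000 * dist t c \<le> 3 * E)" for c
  have "star z \<or> star z0"
  proof (rule ccontr)
    assume "\<not> ?thesis"
    then obtain p t p' t' where
      1: "200000 * g p t < E" "200000 * dist p z > 3 * E" "200000 * dist t z > 3 * E" and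
      2: "200000 * g p' t' < E" "200000 * dist p' z0 > 3 * E" "200000 * dist t' z0 > 3 * E"
      unfolding star_def by (auto simp: not_le)
    define S where "S = g z z0 + g p t + g p' t'"
    have S: "200000 * S < 3 * E" using 1(1) 2(1) small(1) by (simp add: S_def)
    from cl have "E \<le> S \<or> (\<exists>u\<in>{z, z0}. \<exists>v\<in>{p, t}. \<exists>w\<in>{p', t'}. dist u v \<le> S \<and> dist v w \<le> S \<and> dist u w \<le> S)"
      unfolding clustered_def Let_def S_def by blast
    then show False
    proof
      assume "E \<le> S"
      then show False using S E by linarith
    next
      assume "\<exists>u\<in>{z, z0}. \<exists>v\<in>{p, t}. \<exists>w\<in>{p', t'}. dist u v \<le> S \<and> dist v w \<le> S \<and> dist u w \<le> S"
      then show False using 1 2 S by (auto simp: dist_commute)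
    qed
  qed
  then show ?thesis
  proof
    assume "star z"
    then show ?thesis using that[of z z0] small unfolding star_def by blast
  next
    assume "star z0"
    then show ?thesis using that[of z0 z] small unfolding star_def by (metis pair_match_commute)
  qed
qed

lemma star_pot_commute: "star_pot x y l t p = star_pot x y l p t"
  unfolding star_pot_def star_val_def star_min_def match2_def excess_def by (simp add: min.commute max.commute)

lemma star_pot_le:
  assumes "0 \<le> l"
  shows "star_pot x y l p t \<le> max (128 * l) (1000 * pair_match x y p t + 15 * l)"
    and "star_pot x y l p t \<le> max (128 * l) (50000 * dist x p + 1000 * dist y t - l)"
    and "star_pot x y l p t \<le> max (128 * l) (50000 * dist x t + 1000 * dist y p - l)"
  unfolding star_pot_def star_val_def pair_match_def
  using star_min_le(1,3,4)[of "dist x p" "dist x t" "dist y p" "dist y t" l] by auto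

text \<open>3002 = 1001 + 2000 + 1: in the alternative with an offline taxi at z, the term - l must
  cancel the debt 1001 * E, pay at most 2000 * E for moving both taxis, and absorb the error 51000 *
  3 * E / 200000 < E from z being only an almost common point. The floor 128 * 3002 * E fits into
  the reserve.\<close>

lemma star_start_aux:
  assumes g: "pair_lip g" and bal: "balanced 500 x y g E" and E: "0 < E"
    and star: "\<And>p t. 200000 * g p t < E \<Longrightarrow> 200000 * dist p z \<le> 3 * E \<or> 200000 * dist t z \<le> 3 * E"
    and xz: "dist x z \<le> 1000 * E"
  shows "\<exists>y'. alg_step x y (wait_pot x y g E) r z y' (star_pot z y' (3002 * E)) r"
proof -
  obtain y' where y': "dist y y' \<le> dist x z" "dist x y' \<le> dist y z"
    using midway_point[of y x z] by blast
  define c where "c = dist x z + dist y y'"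
  have c: "c \<le> 2 * dist x z" using y' by (simp add: c_def)
  have near: "star_pot z y' (3002 * E) p t + c \<le> wait_pot x y g E p t"
    if pz: "200000 * dist p z \<le> 3 * E" for p t
  proof -
    have 1: "128 * (3002 * E) + c \<le> wait_pot x y g E p t"
      using wait_pot_reserve[OF g bal, of p t] c xz E by simp
    have zp: "dist z p = dist p z" by (rule dist_commute)
    have "50000 * dist z p + 1000 * dist y' t - 3002 * E + c \<le> wait_pot x y g E p t"
    proof (cases "pair_match x y p t = dist x p + dist y t")
      case True
      have "dist y' t \<le> dist y t + dist x z"
        using dist_triangle[of y' t y] y'(1) by (simp add: dist_commute)
      moreover have "dist x z \<le> dist x p + dist p z" by (rule dist_triangle)
      ultimately show ?thesis
        using True c xz pz zp pair_lip_nonneg[OF g, of p t] E unfolding wait_pot_def by simp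
    next
      case False
      then have pm: "pair_match x y p t = dist x t + dist y p" using pair_match_cases by blast
      have "dist y' t \<le> dist x t + dist y z"
        using dist_triangle[of y' t x] y'(2) by (simp add: dist_commute)
      moreover have "dist y z \<le> dist y p + dist p z" by (rule dist_triangle)
      ultimately show ?thesis
        using pm c xz pz zp pair_lip_nonneg[OF g, of p t] E unfolding wait_pot_def by simp
    qed
    then show ?thesis using 1 star_pot_le(2)[of "3002 * E" z y' p t] E by simp
  qed
  have main: "star_pot z y' (3002 * E) p t + c \<le> wait_pot x y g E p t" for p t
  proof (cases "200000 * g p t < E")
    case True
    from star[OF True] show ?thesis
    proof
      assume "200000 * dist p z \<le> 3 * E"
      then show ?thesis by (rule near)
    next
      assume "200000 * dist t z \<le> 3 * E"
      then have "star_pot z y' (3002 * E) t p + c \<le> wait_pot x y g E t p" by (rule near)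
      moreover have "star_pot z y' (3002 * E) t p = star_pot z y' (3002 * E) p t"
        by (rule star_pot_commute)
      ultimately show ?thesis using pair_match_commute[of x y t p] pair_lip_commute[OF g, of t p] by (simp add: wait_pot_def)
    qed
  next
    case False
    \<comment> \<open>For expensive pairs 10^12 * g is at least 5 * 10^6 * E and outweighs every
      other change.\<close>
    have "pair_match z y' p t \<le> pair_match x y p t + 2 * dist x z"
      using pair_match_move[of z y' p t x] pair_match_move[of y' x p t y] y'(1) pair_match_swap[of x y p t] pair_match_swap[of x y' p t]
      by (simp add: dist_commute)
    then have "128 * (3002 * E) + c \<le> wait_pot x y g E p t \<and>
      1000 * pair_match z y' p t + 15 * (3002 * E) + c \<le> wait_pot x y g E p t"
      using False c xz E pair_match_nonneg[of x y p t] unfolding wait_pot_def by simp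
    then show ?thesis using star_pot_le(1)[of "3002 * E" z y' p t] E by linarith
  qed
  have "pot_ok (wait_pot x y g E) (star_pot z y' (3002 * E)) r r c"
    unfolding pot_ok_def using main by simp
  moreover have "server_move x y r z y' r c"
    using server_move_miss[of x y r z y' r] by (simp add: c_def)
  ultimately show ?thesis unfolding alg_step_def by blast
qed

lemma star_start:
  assumes g: "pair_lip g" and cl: "clustered g E" and bal: "balanced 500 x y g E" and E: "0 < E"
    and viol: "\<not> balanced 1000 x y g E"
  shows "\<exists>x' y'. alg_step x y (wait_pot x y g E) r x' y' (star_pot x' y' (3002 * E)) r"
proof -
  obtain z z0 where zo: "pair_match x y z z0 \<le> 1000 * E"
    "\<And>p t. 200000 * g p t < E \<Longrightarrow> 200000 * dist p z \<le> 3 * E \<or> 200000 * dist t z \<le> 3 * E"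
    using violated_star[OF g cl E viol] by blast
  show ?thesis
  proof (cases "dist x z \<le> 1000 * E")
    case True
    have "\<exists>y'. alg_step x y (wait_pot x y g E) r z y' (star_pot z y' (3002 * E)) r"
      using g bal E zo(2) True by (rule star_start_aux)
    then show ?thesis by blast
  next
    case False
    then have yz: "dist y z \<le> 1000 * E"
      using zo(1) pair_match_cases[of x y z z0] zero_le_dist[of x z0] zero_le_dist[of y z0] by linarith
    have eq: "wait_pot y x g E = wait_pot x y g E"
      by (simp add: fun_eq_iff wait_pot_def pair_match_swap[of x y])
    have bal': "balanced 500 y x g E" using bal by (simp add: balanced_def pair_match_swap[of x y])
    have "\<exists>y'. alg_step y x (wait_pot y x g E) r z y' (star_pot z y' (3002 * E)) r"
      using g bal' E zo(2) yz by (rule star_start_aux)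
    then show ?thesis unfolding eq using alg_step_swap1 by blast
  qed
qed

section \<open>Serving one request\<close>

definition waiting :: "linf \<Rightarrow> linf \<Rightarrow> (linf \<Rightarrow> linf \<Rightarrow> real) \<Rightarrow> real \<Rightarrow> bool" where
  "waiting x y g E \<longleftrightarrow> pair_lip g \<and> clustered g E \<and> balanced 1000 x y g E"

definition alg_state :: "linf \<Rightarrow> linf \<Rightarrow> (linf \<Rightarrow> linf \<Rightarrow> real) \<Rightarrow> bool" where
  "alg_state x y F \<longleftrightarrow> (\<exists>g E. 0 < E \<and> waiting x y g E \<and> F = wait_pot x y g E) \<or>
     (\<exists>l\<ge>0. F = star_pot x y l \<or> F = star_pot y x l)"

lemma waiting_swap: "waiting y x g E = waiting x y g E"
  by (simp add: waiting_def balanced_def pair_match_swap[of x y])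

lemma wait_pot_swap: "wait_pot y x g E = wait_pot x y g E"
  by (simp add: fun_eq_iff wait_pot_def pair_match_swap[of x y])

lemma alg_state_wait: "0 < E \<Longrightarrow> waiting x y g E \<Longrightarrow> alg_state x y (wait_pot x y g E)"
  unfolding alg_state_def by blast

lemma alg_state_star: "0 \<le> l \<Longrightarrow> alg_state x y (star_pot x y l)"
  unfolding alg_state_def by blast

lemma plain_pot: "star_pot x y 0 = wait_pot x y (\<lambda>p t. 0) 0"
  by (simp add: fun_eq_iff star_pot_zero wait_pot_def)

lemma waiting_hit:
  assumes "waiting r y g E"
  shows "waiting q y (shift_gauge g r q) E"
  using assms clustered_shift_gauge[of g E r q] pair_lip_shift_gauge[of g r q] balanced_hit[of r y g E q]
    clustered_mono[of "shift_gauge g r q" "E + dist r q" E]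
  unfolding waiting_def by simp

lemma wait_phase:
  assumes "waiting x y g E" "0 < E"
  shows "\<exists>x' y' F' q. dist r q + dist q s = dist r s \<and> alg_step x y (wait_pot x y g E) r x' y' F' q \<and>
    (q = s \<and> alg_state x' y' F' \<or> (\<exists>l\<ge>0. F' = star_pot x' y' l))"
proof -
  \<comment> \<open>Pieces have length E / 4 except possibly the last, and E never decreases, so n
    bounds their number in advance.\<close>
  obtain n :: nat where "dist r s / (E / 4) \<le> real n" using real_arch_simple by blast
  then have "4 * dist r s \<le> real n * E" using assms(2) by (simp add: field_simps)
  with assms show ?thesis
  proof (induction n arbitrary: r g E)
    case 0
    then have "r = s" by simp
    then show ?case using alg_step_refl[of x y "wait_pot x y g E" r] alg_state_wait[OF 0(2,1)]
      by (intro exI[of _ x] exI[of _ y] exI[of _ "wait_pot x y g E"] exI[of _ r]) simp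
  next
    case (Suc n)
    have g: "pair_lip g" "clustered g E" "balanced 1000 x y g E" using Suc.prems(1) by (auto simp: waiting_def)
    show ?case
    proof (cases "x = r \<or> y = r")
      case True
      then obtain y0 where y0: "(x = r \<and> y0 = y) \<or> (y = r \<and> y0 = x)" by blast
      have w: "waiting r y0 g E" using y0 Suc.prems(1) waiting_swap by metis
      have F: "wait_pot x y g E = wait_pot r y0 g E" using y0 wait_pot_swap by metis
      have "alg_step r y0 (wait_pot r y0 g E) r s y0 (wait_pot s y0 (shift_gauge g r s) E) s"
        by (rule wait_step_hit)
      then have st: "alg_step x y (wait_pot x y g E) r s y0 (wait_pot s y0 (shift_gauge g r s) E) s"
        unfolding F using y0 alg_step_swap1 by metis
      have "alg_state s y0 (wait_pot s y0 (shift_gauge g r s) E)"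
        using alg_state_wait[OF Suc.prems(2) waiting_hit[OF w]] Suc.prems(2) by simp
      with st show ?thesis by (metis add.right_neutral dist_self)
    next
      case False
      define b where "b = min (dist r s) (E / 4)"
      have b: "0 \<le> b" "b \<le> dist r s" "4 * b \<le> E" using Suc.prems(2) by (auto simp: b_def)
      obtain q where q: "dist r q = b" "dist q s = dist r s - b" using segment_point[OF b(1,2)] by blast
      define g' E' where "g' = shift_gauge g r q" and "E' = E + b"
      have g': "pair_lip g'" "clustered g' E'" "balanced 500 x y g' E'"
        using pair_lip_shift_gauge[OF g(1), of r q] clustered_shift_gauge[OF g(1,2), of r q]
          balanced_stay[OF _ g(3), of r q] b Suc.prems(2) q
        by (simp_all add: g'_def E'_def)
      have E': "0 < E'" using Suc.prems(2) b by (simp add: E'_def)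
      have step: "alg_step x y (wait_pot x y g E) r x y (wait_pot x y g' E') q"
        using wait_step_miss[of x y g E r q] by (simp add: g'_def E'_def q)
      show ?thesis
      proof (cases "balanced 1000 x y g' E'")
        case True
        have "4 * dist q s \<le> real n * E'"
        proof (cases "dist r s \<le> E / 4")
          case True
          then show ?thesis using q E' by (simp add: b_def)
        next
          case False
          then have "b = E / 4" by (simp add: b_def)
          then have "4 * dist q s \<le> real n * E" using q Suc.prems(3) by (simp add: algebra_simps)
          also have "\<dots> \<le> real n * E'" using b by (simp add: E'_def mult_left_mono)
          finally show ?thesis .
        qed
        have "waiting x y g' E'" using True g' by (simp add: waiting_def)
        from Suc.IH[OF this E' \<open>4 * dist q s \<le> real n * E'\<close>] obtain x'' y'' F'' q' where *:
          "dist q q' + dist q' s = dist q s" "alg_step x y (wait_pot x y g' E') q x'' y'' F'' q'"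
          "q' = s \<and> alg_state x'' y'' F'' \<or> (\<exists>l\<ge>0. F'' = star_pot x'' y'' l)"
          by blast
        have "dist r q + dist q q' = dist r q'"
          using *(1) q dist_triangle[of r q' q] dist_triangle[of r s q'] by linarith
        moreover from this have "dist r q' + dist q' s = dist r s" using *(1) q by linarith
        ultimately show ?thesis using alg_step_trans[OF step *(2)] *(3) by blast
      next
        case False
        from star_start[OF g' E' this, of q] obtain x' y' where
          "alg_step x y (wait_pot x y g' E') q x' y' (star_pot x' y' (3002 * E')) q" by blast
        from alg_step_trans[OF step this] have
          "alg_step x y (wait_pot x y g E) r x' y' (star_pot x' y' (3002 * E')) q" by simp
        moreover have "dist r q + dist q s = dist r s" using q by simp
        moreover have "0 \<le> 3002 * E'" using E' by simp
        ultimately show ?thesis by blast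
      qed
    qed
  qed
qed

text \<open>A pair that declined has gauge dist r s, which suffices by itself. Any other pair has a
  member within dist r s of s, hence at distance at least 1998 * dist r s from both parked
  taxis.\<close>

lemma waiting_from_zero:
  assumes "2000 * dist r s \<le> dist x r" "2000 * dist r s \<le> dist y r"
  shows "waiting x y (shift_gauge (\<lambda>p t. 0) r s) (dist r s)"
proof -
  let ?g = "shift_gauge (\<lambda>p t. 0) r s"
  have "1000 * dist r s \<le> pair_match x y p t + 2 * 10^8 * ?g p t" for p t
  proof -
    have far: "1000 * dist r s \<le> pair_match x y p t" if "dist p s \<le> dist r s \<or> dist t s \<le> dist r s" for p t
    proof -
      have "2000 * dist r s \<le> dist z u + dist r s + dist u s" if "z = x \<or> z = y" for z u
        using assms that dist_triangle[of z r u] dist_triangle[of u r s] dist_commute[of s r] by auto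
      note this[of x p, simplified] this[of x t, simplified] this[of y p, simplified] this[of y t, simplified]
      then show ?thesis
        using pair_match_cases[of x y p t] that zero_le_dist[of x p] zero_le_dist[of x t] zero_le_dist[of y p] zero_le_dist[of y t]
        by linarith
    qed
    show ?thesis
    proof (cases rule: shift_gauge_cases[of "\<lambda>p t. 0" r s p t])
      case stay
      then show ?thesis using pair_match_nonneg[of x y p t] zero_le_dist[of r s] by (simp del: zero_le_dist)
    next
      case left
      then have "dist p s \<le> dist r s" using shift_gauge_le(1)[of "\<lambda>p t. 0" r s p t] by simp
      then show ?thesis using far[of p t] left by (simp add: add_increasing2)
    next
      case right
      then have "dist t s \<le> dist r s" using shift_gauge_le(1)[of "\<lambda>p t. 0" r s p t] by simp
      then show ?thesis using far[of p t] right by (simp add: add_increasing2)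
    qed
  qed
  then have "balanced 1000 x y ?g (dist r s)" unfolding balanced_def by blast
  then show ?thesis
    using pair_lip_shift_gauge[OF pair_lip_zero, of r s] clustered_shift_gauge[OF pair_lip_zero clustered_zero, of r s]
    by (simp add: waiting_def)
qed

text \<open>If the offline algorithm accepted, it has a taxi at s, which becomes the centre, and the
  old matching costs at least D. The budget 2 * D makes the term - l pay exactly for moving both
  taxis. If it declined, its charge is large enough because D is below 2000 * dist r s.\<close>

lemma plain_board:
  assumes near: "dist x r \<le> dist y r" and a: "dist x r < 2000 * dist r s"
  shows "\<exists>x' y' F'. alg_step x y (star_pot x y 0) r x' y' F' s \<and> alg_state x' y' F'"
proof -
  define D where "D = dist x r"
  obtain y' where y': "dist y y' \<le> D" "dist x y' \<le> dist y r"
    using midway_point[of y x r] unfolding D_def by blast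
  have D: "0 \<le> D" by (simp add: D_def)
  have own: "star_pot s y' (2 * D) s t + 2 * D \<le> star_pot x y 0 r t" for t
  proof -
    have pm: "D \<le> pair_match x y r t" using pair_match_cases[of x y r t] near zero_le_dist[of y t] zero_le_dist[of x t] unfolding D_def by linarith
    have "dist y' t \<le> dist y t + D" "dist y' t \<le> dist x t + dist y r"
      using dist_triangle[of y' t y] dist_triangle[of y' t x] y' dist_commute[of y y'] dist_commute[of x y'] by linarith+
    then have "dist y' t \<le> pair_match x y r t" using pair_match_cases[of x y r t] unfolding D_def by linarith
    then have "max (128 * (2 * D)) (50000 * dist s s + 1000 * dist y' t - 2 * D) + 2 * D \<le> 1000 * pair_match x y r t"
      using pm D by simp
    then show ?thesis using star_pot_le(2)[of "2 * D" s y' s t] D unfolding star_pot_zero by linarith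
  qed
  have "star_pot s y' (2 * D) p t + 2 * D \<le> star_pot x y 0 p t + 10^14 * dist r s" for p t
  proof -
    have "dist x s \<le> D + dist r s" unfolding D_def by (rule dist_triangle)
    then have "pair_match s y' p t \<le> pair_match x y p t + 2 * D + dist r s"
      using pair_match_move[of s y' p t x] pair_match_move[of y' x p t y] y'(1) pair_match_swap[of x y p t] pair_match_swap[of x y' p t]
      by simp
    then have "max (128 * (2 * D)) (1000 * pair_match s y' p t + 15 * (2 * D)) + 2 * D
        \<le> 1000 * pair_match x y p t + 10^14 * dist r s"
      using a D pair_match_nonneg[of x y p t] unfolding D_def[symmetric] by simp
    then show ?thesis using star_pot_le(1)[of "2 * D" s y' p t] D unfolding star_pot_zero by linarith
  qed
  then have "pot_ok (star_pot x y 0) (star_pot s y' (2 * D)) r s (2 * D)" using own unfolding pot_ok_def by blast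
  moreover have "server_move x y r s y' s (2 * D)"
    by (rule server_move_mono[OF server_move_board]) (use y' in \<open>simp add: D_def\<close>)
  ultimately show ?thesis using alg_state_star[of "2 * D" s y'] D unfolding alg_step_def by auto
qed

lemma plain_phase: "\<exists>x' y' F'. alg_step x y (star_pot x y 0) r x' y' F' s \<and> alg_state x' y' F'"
proof (cases "r = s")
  case True
  then show ?thesis using alg_step_refl[of x y "star_pot x y 0" r] alg_state_star[of 0 x y] by auto
next
  case False
  consider "2000 * dist r s \<le> dist x r" "2000 * dist r s \<le> dist y r"
    | "dist x r \<le> dist y r" "dist x r < 2000 * dist r s"
    | "dist y r \<le> dist x r" "dist y r < 2000 * dist r s" by linarith
  then show ?thesis
  proof cases
    case 1
    have "alg_step x y (star_pot x y 0) r x y (wait_pot x y (shift_gauge (\<lambda>p t. 0) r s) (dist r s)) s"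
      unfolding plain_pot using wait_step_miss[of x y "\<lambda>p t. 0" 0 r s] by simp
    then show ?thesis using alg_state_wait[OF _ waiting_from_zero[OF 1]] False by fastforce
  next
    case 2
    then show ?thesis by (rule plain_board)
  next
    case 3
    have "star_pot y x 0 = star_pot x y 0" by (simp add: fun_eq_iff star_pot_zero pair_match_swap[of x y])
    with plain_board[OF 3] show ?thesis using alg_step_swap1 by metis
  qed
qed

lemma star_serve:
  assumes "0 \<le> l"
  shows "\<exists>x' y' F'. alg_step x y (star_pot x y l) r x' y' F' s \<and> alg_state x' y' F'"
proof -
  from star_phase[OF assms, of s r x y] obtain x' y' l' q where *: "0 \<le> l'" "l' = 0 \<or> q = s"
    "dist r q + dist q s = dist r s" "alg_step x y (star_pot x y l) r x' y' (star_pot x' y' l') q" by blast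
  show ?thesis
  proof (cases "q = s")
    case True
    then show ?thesis using * alg_state_star by blast
  next
    case False
    then have l': "l' = 0" using *(2) by simp
    from plain_phase[of x' y' q s] obtain x'' y'' F'' where
      "alg_step x' y' (star_pot x' y' 0) q x'' y'' F'' s" "alg_state x'' y'' F''" by blast
    then show ?thesis using alg_step_trans[OF *(4)[unfolded l']] *(3) by blast
  qed
qed

text \<open>Within one ride the phase can change only from waiting to star and from star to plain,
  and the plain phase completes the ride in one step, so no recursion over phases is needed.\<close>

lemma serve_request:
  assumes "alg_state x y F"
  shows "\<exists>x' y' F'. alg_step x y F r x' y' F' s \<and> alg_state x' y' F'"
  using assms unfolding alg_state_def[of x y]
proof (elim disjE exE conjE)
  fix g E assume "0 < E" "waiting x y g E" and F: "F = wait_pot x y g E"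
  from wait_phase[OF this(2,1), of r s] obtain x' y' F' q where *:
    "dist r q + dist q s = dist r s" "alg_step x y F r x' y' F' q"
    "q = s \<and> alg_state x' y' F' \<or> (\<exists>l\<ge>0. F' = star_pot x' y' l)" unfolding F by blast
  show ?thesis
  proof (cases "q = s \<and> alg_state x' y' F'")
    case True
    then show ?thesis using * by blast
  next
    case False
    then obtain l where "0 \<le> l" "F' = star_pot x' y' l" using *(3) by blast
    with star_serve[of l x' y' q s] show ?thesis using alg_step_trans[OF *(2) _ *(1)] by blast
  qed
next
  fix l :: real assume "0 \<le> l" "F = star_pot x y l"
  then show ?thesis using star_serve by blast
next
  fix l :: real assume "0 \<le> l" "F = star_pot y x l"
  then show ?thesis using star_serve[of l y x r s] alg_step_swap1 by blast
qed

lemma alg_state_nonneg: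
  assumes "alg_state x y F"
  shows "0 \<le> F p t"
  using assms unfolding alg_state_def
proof (elim disjE exE conjE)
  fix g E assume "0 < E" "waiting x y g E" "F = wait_pot x y g E"
  then have "1000 * E \<le> pair_match x y p t + 2 * 10^8 * g p t" "0 \<le> g p t"
    by (auto simp: waiting_def balanced_def pair_lip_nonneg)
  then show ?thesis using \<open>F = _\<close> \<open>0 < E\<close> pair_match_nonneg[of x y p t] by (simp add: wait_pot_def)
qed (auto simp: star_pot_def star_val_def)

lemma alg_state_commute:
  assumes "alg_state x y F"
  shows "F t p = F p t"
  using assms star_pot_commute pair_lip_commute pair_match_commute unfolding alg_state_def waiting_def wait_pot_def by fastforce

lemma alg_state_lipschitz:
  assumes "alg_state x y F"
  shows "F p' t \<le> F p t + 10^14 * dist p p'"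
proof -
  have star: "star_pot x y l p' t \<le> star_pot x y l p t + 10^14 * dist p p'" for x y l
  proof -
    have "star_pot x y l p' t \<le> star_pot x y l p t + 60000 * dist p p' + 10 * l - 10 * l"
      unfolding star_pot_def
      using dist_triangle[of x p' p] dist_triangle[of y p' p] by (intro star_val_change) auto
    then show ?thesis using zero_le_dist[of p p'] by (simp del: zero_le_dist)
  qed
  show ?thesis
    using assms unfolding alg_state_def
  proof (elim disjE exE conjE)
    fix g E assume "0 < E" "waiting x y g E" "F = wait_pot x y g E"
    then show ?thesis
      using pair_match_lipschitz[of x y p' t p] pair_lip_lipschitz[of g p' t p] zero_le_dist[of p p']
      by (simp add: wait_pot_def waiting_def del: zero_le_dist)
  qed (use star in auto)
qed

section \<open>The online algorithm on countable spaces\<close>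

fun taxi_end :: "'a multiset \<Rightarrow> ('a \<times> 'a) list \<Rightarrow> 'a multiset list \<Rightarrow> 'a multiset" where
  "taxi_end C ((r, s) # rs) (H # Hs) = taxi_end (H - {#r#} + {#s#}) rs Hs"
| "taxi_end C _ _ = C"

section \<open>Schedules and online runs extended by one request\<close>

lemma taxi_cost_snoc:
  "length Hs = length rs \<Longrightarrow>
    taxi_cost d C (rs @ [(r, s)]) (Hs @ [H]) = taxi_cost d C rs Hs + matching_dist d (taxi_end C rs Hs) H"
  by (induction d C rs Hs rule: taxi_cost.induct) auto

lemma taxi_end_snoc:
  "length Hs = length rs \<Longrightarrow> taxi_end C (rs @ [(r, s)]) (Hs @ [H]) = H - {#r#} + {#s#}"
  by (induction C rs Hs rule: taxi_end.induct) auto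

lemma serves_length: "serves M k rs Hs \<Longrightarrow> length Hs = length rs"
  unfolding serves_def by (simp add: list_all2_lengthD)

lemma serves_snoc: "serves M k (rs @ [(r, s)]) (Hs @ [H]) \<longleftrightarrow>
    serves M k rs Hs \<and> H \<in> multisets_of_size M k \<and> r \<in># H"
  unfolding serves_def
  by (cases "length rs = length Hs") (auto simp: list_all2_append dest: list_all2_lengthD)

lemma serves_snocE:
  assumes "serves M k (rs @ [(r, s)]) Hs'"
  obtains Hs H where "Hs' = Hs @ [H]" "serves M k rs Hs" "H \<in> multisets_of_size M k" "r \<in># H"
proof -
  have "Hs' \<noteq> []" using serves_length[OF assms] by auto
  then obtain Hs H where "Hs' = Hs @ [H]" by (metis rev_exhaust)
  then show ?thesis using that assms serves_snoc by metis
qed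

lemma serves_exists:
  assumes "0 < k" "rs \<in> lists (M \<times> M)"
  shows "\<exists>Hs. serves M k rs Hs"
proof -
  have "serves M k rs (map (\<lambda>(r, s). replicate_mset k r) rs)"
    using assms unfolding serves_def multisets_of_size_def
    by (auto simp: list_all2_map2 list_all2_same)
  then show ?thesis by blast
qed

lemma taxi_opt_ge:
  assumes "0 < k" "rs \<in> lists (M \<times> M)" "\<And>Hs. serves M k rs Hs \<Longrightarrow> b \<le> taxi_cost d C rs Hs"
  shows "b \<le> taxi_opt M d k C rs"
  unfolding taxi_opt_def using serves_exists[OF assms(1,2)] assms(3) by (intro cINF_greatest) auto

lemma online_run_Nil [simp]: "online_run A [] = []"
  by (simp add: online_run_def)

lemma online_run_snoc: "online_run A (rs @ [q]) = online_run A rs @ [A (rs @ [q])]"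
  by (auto simp: online_run_def)

text \<open>An algorithm sees nothing but the requests, so it replays the game from the start:
  folding \<open>next_pos\<close> reconstructs its position and cost, and the choice made by
  \<open>pick\<close> depends on these data alone.\<close>

lemma online_alg_from_invariant:
  assumes init: "W [] C0 0"
    and step: "\<And>rs R c r s. W rs R c \<Longrightarrow> r \<in> M \<Longrightarrow> s \<in> M \<Longrightarrow>
      \<exists>H. H \<in> multisets_of_size M k \<and> r \<in># H \<and> W (rs @ [(r, s)]) (H - {#r#} + {#s#}) (c + matching_dist d R H)"
  shows "\<exists>A. valid_online_alg M k A \<and>
    (\<forall>rs\<in>lists (M \<times> M). \<exists>R. W rs R (taxi_cost d C0 rs (online_run A rs)))"
proof -
  define pick where "pick rs R c q = (SOME H. H \<in> multisets_of_size M k \<and> fst q \<in># H \<and>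
    W (rs @ [q]) (H - {#fst q#} + {#snd q#}) (c + matching_dist d R H))" for rs R c q
  have pick: "pick rs R c q \<in> multisets_of_size M k \<and> fst q \<in># pick rs R c q \<and>
      W (rs @ [q]) (pick rs R c q - {#fst q#} + {#snd q#}) (c + matching_dist d R (pick rs R c q))"
    if "W rs R c" "q \<in> M \<times> M" for rs R c q
    unfolding pick_def by (rule someI_ex) (use step[of rs R c "fst q" "snd q"] that in auto)
  define next_pos where "next_pos st q = (case st of (rs, R, c) \<Rightarrow>
    (rs @ [q], pick rs R c q - {#fst q#} + {#snd q#}, c + matching_dist d R (pick rs R c q)))" for st q
  define pos where "pos rs = foldl next_pos ([], C0, 0) rs" for rs
  define A where "A rs = (case pos (butlast rs) of (rs', R, c) \<Rightarrow> pick rs' R c (last rs))" for rs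
  have main: "serves M k rs (online_run A rs) \<and>
      pos rs = (rs, taxi_end C0 rs (online_run A rs), taxi_cost d C0 rs (online_run A rs)) \<and>
      W rs (taxi_end C0 rs (online_run A rs)) (taxi_cost d C0 rs (online_run A rs))"
    if "rs \<in> lists (M \<times> M)" for rs
    using that
  proof (induction rs rule: rev_induct)
    case Nil
    then show ?case using init by (simp add: pos_def serves_def)
  next
    case (snoc q rs)
    obtain r s where q: "q = (r, s)" by (cases q)
    let ?Hs = "online_run A rs"
    from snoc have IH: "serves M k rs ?Hs" "pos rs = (rs, taxi_end C0 rs ?Hs, taxi_cost d C0 rs ?Hs)"
      "W rs (taxi_end C0 rs ?Hs) (taxi_cost d C0 rs ?Hs)" by auto
    define H where "H = pick rs (taxi_end C0 rs ?Hs) (taxi_cost d C0 rs ?Hs) q"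
    have A: "A (rs @ [q]) = H" by (simp add: A_def IH(2) H_def)
    have H: "H \<in> multisets_of_size M k" "r \<in># H"
      "W (rs @ [q]) (H - {#r#} + {#s#}) (taxi_cost d C0 rs ?Hs + matching_dist d (taxi_end C0 rs ?Hs) H)"
      using pick[OF IH(3), of q] snoc.prems by (auto simp: H_def q)
    have "pos (rs @ [q]) = next_pos (pos rs) q" by (simp add: pos_def)
    then have "pos (rs @ [q]) = (rs @ [q], H - {#r#} + {#s#}, taxi_cost d C0 rs ?Hs + matching_dist d (taxi_end C0 rs ?Hs) H)"
      by (simp add: IH(2) next_pos_def H_def q)
    then show ?case
      using H IH(1) A taxi_cost_snoc[OF serves_length[OF IH(1)], of d C0 r s H]
        taxi_end_snoc[OF serves_length[OF IH(1)], of C0 r s H] serves_snoc[of M k rs r s ?Hs H]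
      by (simp add: online_run_snoc q)
  qed
  then have "valid_online_alg M k A" unfolding valid_online_alg_def by blast
  with main show ?thesis by blast
qed

lemma kuratowski_embedding:
  fixes M :: "nat set"
  assumes "Metric_space M d"
  shows "\<exists>e :: nat \<Rightarrow> linf. \<forall>i\<in>M. \<forall>j\<in>M. dist (e i) (e j) = d i j"
proof (cases "M = {}")
  case False
  then obtain p0 where p0: "p0 \<in> M" by blast
  interpret Metric_space M d by fact
  \<comment> \<open>Subtracting the distances from a base point keeps the functions bounded when the
    space is not.\<close>
  define f where "f i j = (if j \<in> M then d i j - d p0 j else 0)" for i j
  have f_diff: "\<bar>f i j - f i' j\<bar> \<le> d i i'" if "i \<in> M" "i' \<in> M" for i i' j
    using triangle[of i i' j] triangle[of i' i j] that commute[of i i'] by (auto simp: f_def)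
  have "\<exists>g :: linf. apply_bcontfun g = f i" if i: "i \<in> M" for i
  proof -
    have "bounded (range (f i))"
      unfolding bounded_iff
    proof (intro exI ballI)
      fix v assume "v \<in> range (f i)"
      then obtain j where "v = f i j" by blast
      moreover have "f p0 j = 0" by (simp add: f_def)
      ultimately show "norm v \<le> d i p0" using f_diff[OF i p0, of j] by simp
    qed
    then have "f i \<in> bcontfun" by (auto simp: bcontfun_def)
    then show ?thesis by (metis bcontfunE)
  qed
  then obtain e :: "nat \<Rightarrow> linf" where e: "\<And>i. i \<in> M \<Longrightarrow> apply_bcontfun (e i) = f i" by metis
  have "dist (e i) (e j) = d i j" if ij: "i \<in> M" "j \<in> M" for i j
  proof (rule antisym)
    show "dist (e i) (e j) \<le> d i j"
      using f_diff[OF ij] by (intro dist_bound) (simp add: e ij dist_real_def)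
    have "\<bar>f i j - f j j\<bar> = d i j" using ij by (simp add: f_def)
    then show "d i j \<le> dist (e i) (e j)"
      using linf_dist_le[of "e i" j "e j"] by (simp add: e ij)
  qed
  then show ?thesis by blast
qed auto

section \<open>The potential under offline moves\<close>

lemma matching_dist_pair_cases:
  fixes d :: "'a \<Rightarrow> 'a \<Rightarrow> real"
  shows "d p p' + d t t' \<le> matching_dist d {#p, t#} {#p', t'#} \<or> d t p' + d p t' \<le> matching_dist d {#p, t#} {#p', t'#}"
proof -
  have single: "d a b \<le> matching_dist d {#a#} {#b#}" for a b
  proof -
    have "\<exists>x\<in>#{#a#}. d x b + matching_dist d ({#a#} - {#x#}) ({#b#} - {#b#}) \<le> matching_dist d {#a#} {#b#}"
      by (rule matching_dist_remove) auto
    moreover have "0 \<le> matching_dist d {#} {#}" by (rule matching_dist_nonneg) auto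
    ultimately show ?thesis by auto
  qed
  have "\<exists>x\<in>#{#p, t#}. d x p' + matching_dist d ({#p, t#} - {#x#}) ({#p', t'#} - {#p'#}) \<le> matching_dist d {#p, t#} {#p', t'#}"
    by (rule matching_dist_remove) auto
  then consider "d p p' + matching_dist d {#t#} {#t'#} \<le> matching_dist d {#p, t#} {#p', t'#}"
    | "d t p' + matching_dist d {#p#} {#t'#} \<le> matching_dist d {#p, t#} {#p', t'#}"
    by (auto split: if_splits)
  then show ?thesis using single[of t t'] single[of p t'] by cases linarith+
qed

lemma potential_lipschitz_pair:
  assumes "alg_state x y F"
  shows "F p' t' \<le> F p t + 10^14 * conf_dist {#p, t#} {#p', t'#}"
proof -
  have lip: "F p' t' \<le> F p t + 10^14 * (dist p p' + dist t t')" for p t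
    using alg_state_lipschitz[OF assms, of p' t' p] alg_state_lipschitz[OF assms, of t' p t]
      alg_state_commute[OF assms, of t' p] alg_state_commute[OF assms, of t p]
    by (simp add: distrib_left)
  have 1: "F p' t' \<le> F p t + 10^14 * (dist p p' + dist t t')" "F p' t' \<le> F p t + 10^14 * (dist t p' + dist p t')"
    using lip[of p t] lip[of t p] alg_state_commute[OF assms, of t p] by simp_all
  show ?thesis
    using matching_dist_pair_cases[of dist p p' t t']
  proof
    assume "dist p p' + dist t t' \<le> conf_dist {#p, t#} {#p', t'#}"
    then show ?thesis using 1(1) by simp
  next
    assume "dist t p' + dist p t' \<le> conf_dist {#p, t#} {#p', t'#}"
    then show ?thesis using 1(2) by simp
  qed
qed

text \<open>If the taxi at s drives to r, the ride is declined and dist s r pays. If a parked taxi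
  drives to r, the Lipschitz bound pays for the approach; the ride is then accepted, which leaves
  the taxi at s as the parked one.\<close>

lemma potential_offline_move:
  assumes F: "alg_state x y F" and F': "alg_state x' y' F'" and ok: "pot_ok F F' r s a"
  shows "F' p' t' + a \<le> F p t + 10^14 * conf_dist {#s, p, t#} {#r, p', t'#}"
proof -
  have "\<exists>z\<in>#{#s, p, t#}. dist z r + conf_dist ({#s, p, t#} - {#z#}) ({#r, p', t'#} - {#r#}) \<le> conf_dist {#s, p, t#} {#r, p', t'#}"
    by (rule matching_dist_remove) auto
  then have "dist s r + conf_dist {#p, t#} {#p', t'#} \<le> conf_dist {#s, p, t#} {#r, p', t'#} \<or>
    dist p r + conf_dist {#s, t#} {#p', t'#} \<le> conf_dist {#s, p, t#} {#r, p', t'#} \<or>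
    dist t r + conf_dist {#s, p#} {#p', t'#} \<le> conf_dist {#s, p, t#} {#r, p', t'#}"
    by (auto simp: add_mset_commute split: if_splits)
  then consider "dist s r + conf_dist {#p, t#} {#p', t'#} \<le> conf_dist {#s, p, t#} {#r, p', t'#}"
    | "dist p r + conf_dist {#s, t#} {#p', t'#} \<le> conf_dist {#s, p, t#} {#r, p', t'#}"
    | "dist t r + conf_dist {#s, p#} {#p', t'#} \<le> conf_dist {#s, p, t#} {#r, p', t'#}" by blast
  then show ?thesis
  proof cases
    case 1
    have "F' p t + a \<le> F p t + 10^14 * dist r s" using ok unfolding pot_ok_def by blast
    then show ?thesis
      using 1 potential_lipschitz_pair[OF F', of p' t' p t] dist_commute[of r s] by simp
  next
    case 2
    have "F' s t + a \<le> F r t" using ok unfolding pot_ok_def by blast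
    then show ?thesis
      using 2 potential_lipschitz_pair[OF F', of p' t' s t] alg_state_lipschitz[OF F, of r t p] by simp
  next
    case 3
    have "F' s p + a \<le> F r p" using ok unfolding pot_ok_def by blast
    then show ?thesis
      using 3 potential_lipschitz_pair[OF F', of p' t' s p] alg_state_lipschitz[OF F, of r p t]
        alg_state_commute[OF F, of t p] by simp
  qed
qed

lemma matching_dist_image:
  assumes "size C = size D" "\<And>x y. x \<in># C \<Longrightarrow> y \<in># D \<Longrightarrow> d' (e x) (e y) = d x y"
  shows "matching_dist d' (image_mset e C) (image_mset e D) \<le> matching_dist d C D"
proof -
  obtain N where N: "N \<in> perfect_matchings C D" "matching_dist d C D = (\<Sum>(x, y)\<in>#N. d x y)"
    using matching_dist_attained[OF assms(1), of d] by blast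
  then have CD: "image_mset fst N = C" "image_mset snd N = D" by (auto simp: perfect_matchings_def)
  have "image_mset (map_prod e e) N \<in> perfect_matchings (image_mset e C) (image_mset e D)"
    using CD by (auto simp: perfect_matchings_def multiset.map_comp comp_def)
  from matching_dist_le[OF this, of d'] have "matching_dist d' (image_mset e C) (image_mset e D) \<le> (\<Sum>(x, y)\<in>#N. d' (e x) (e y))"
    by (simp add: multiset.map_comp comp_def case_prod_unfold)
  also have "(\<Sum>(x, y)\<in>#N. d' (e x) (e y)) = (\<Sum>(x, y)\<in>#N. d x y)"
    by (intro arg_cong[where f = sum_mset] image_mset_cong) (use assms(2) CD in \<open>force split: prod.splits\<close>)
  finally show ?thesis using N(2) by simp
qed

lemma mset_size_2: "size X = 2 \<Longrightarrow> \<exists>p t. X = {#p, t#}"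
  by (metis ex_mset size_mset length_Suc_conv length_0_conv mset.simps numeral_2_eq_2)

lemma mset_size_3: "size X = 3 \<Longrightarrow> \<exists>s p t. X = {#s, p, t#}"
  by (metis ex_mset size_mset length_Suc_conv length_0_conv mset.simps numeral_3_eq_3)

lemma competitive_algorithm_nat:
  fixes M :: "nat set"
  assumes "Metric_space M d" "C0 \<in> multisets_of_size M 3"
  shows "\<exists>A. valid_online_alg M 3 A \<and> competitive M d 3 C0 A (10^14)"
proof -
  interpret Metric_space M d by fact
  obtain e :: "nat \<Rightarrow> linf" where e: "\<And>i j. i \<in> M \<Longrightarrow> j \<in> M \<Longrightarrow> dist (e i) (e j) = d i j"
    using kuratowski_embedding[OF assms(1)] by blast
  obtain s0 p0 t0 where C0: "C0 = {#s0, p0, t0#}"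
    using mset_size_3[of C0] assms(2) unfolding multisets_of_size_def by blast
  then have M0: "s0 \<in> M" "p0 \<in> M" "t0 \<in> M" using assms(2) by (auto simp: multisets_of_size_def)
  \<comment> \<open>The matching between real and virtual taxis is the driving that the lazy real
    taxis still owe.\<close>
  define W where "W rs R c \<longleftrightarrow> (\<exists>s\<in>M. \<exists>x y F. alg_state x y F \<and> R \<in> multisets_of_size M 3 \<and>
    (\<forall>Hs. serves M 3 rs Hs \<longrightarrow> (\<exists>p\<in>M. \<exists>t\<in>M. taxi_end C0 rs Hs = {#s, p, t#} \<and>
      c + conf_dist (image_mset e R) {#e s, x, y#} + F (e p) (e t) \<le> 10^14 * taxi_cost d C0 rs Hs)))" for rs R c
  have "W [] C0 0"
  proof -
    have "star_pot (e p0) (e t0) 0 (e p0) (e t0) = 0" using pair_match_le(1)[of "e p0" "e t0" "e p0" "e t0"]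
      pair_match_nonneg[of "e p0" "e t0" "e p0" "e t0"] by (simp add: star_pot_zero)
    moreover have "conf_dist (image_mset e C0) {#e s0, e p0, e t0#} = 0" by (simp add: C0 conf_dist_refl)
    ultimately have "taxi_end C0 [] Hs = {#s0, p0, t0#} \<and> 0 + conf_dist (image_mset e C0) {#e s0, e p0, e t0#} +
      star_pot (e p0) (e t0) 0 (e p0) (e t0) \<le> 10^14 * taxi_cost d C0 [] Hs" for Hs
      by (simp add: C0)
    then have "alg_state (e p0) (e t0) (star_pot (e p0) (e t0) 0) \<and> C0 \<in> multisets_of_size M 3 \<and>
      (\<forall>Hs. serves M 3 [] Hs \<longrightarrow> (\<exists>p\<in>M. \<exists>t\<in>M. taxi_end C0 [] Hs = {#s0, p, t#} \<and>
        0 + conf_dist (image_mset e C0) {#e s0, e p0, e t0#} + star_pot (e p0) (e t0) 0 (e p) (e t)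
          \<le> 10^14 * taxi_cost d C0 [] Hs))"
      using M0 assms(2) alg_state_star[of 0 "e p0" "e t0"] by blast
    then show ?thesis unfolding W_def using M0(1) by blast
  qed
  moreover have "\<exists>H. H \<in> multisets_of_size M 3 \<and> r \<in># H \<and> W (rs @ [(r, s')]) (H - {#r#} + {#s'#}) (c + matching_dist d R H)"
    if W: "W rs R c" and r: "r \<in> M" and s': "s' \<in> M" for rs R c r s'
  proof -
    obtain s x y F where s: "s \<in> M" and F: "alg_state x y F" and R: "R \<in> multisets_of_size M 3" and
      pot: "\<And>Hs. serves M 3 rs Hs \<Longrightarrow> \<exists>p\<in>M. \<exists>t\<in>M. taxi_end C0 rs Hs = {#s, p, t#} \<and>
        c + conf_dist (image_mset e R) {#e s, x, y#} + F (e p) (e t) \<le> 10^14 * taxi_cost d C0 rs Hs"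
      using W unfolding W_def by blast
    obtain x' y' F' a where step: "alg_state x' y' F'" "pot_ok F F' (e r) (e s) a" "server_move x y (e r) x' y' (e s) a"
      using serve_request[OF F, of "e r" "e s"] unfolding alg_step_def by blast
    have RM: "set_mset R \<subseteq> M" "size R = 3" using R by (auto simp: multisets_of_size_def)
    let ?R = "image_mset e R"
    have "\<exists>z\<in>#?R. dist z (e r) + conf_dist (?R - {#z#}) ({#e r, x', y'#} - {#e r#}) \<le> conf_dist ?R {#e r, x', y'#}"
      using RM by (intro matching_dist_remove) auto
    then obtain i where i: "i \<in># R" "dist (e i) (e r) + conf_dist (?R - {#e i#}) {#x', y'#} \<le> conf_dist ?R {#e r, x', y'#}"
      by auto
    obtain R' where R': "R = add_mset i R'" using i(1) by (meson multi_member_split)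
    have iM: "i \<in> M" and R'M: "set_mset R' \<subseteq> M" "size R' = 2" using RM R' by auto
    \<comment> \<open>Only the real taxi matched with the pick-up moves; the others leave their
      share of the matching as debt.\<close>
    define H where "H = add_mset r R'"
    have H: "H \<in> multisets_of_size M 3" "r \<in># H" "H - {#r#} + {#s'#} = add_mset s' R'"
      using r R'M by (auto simp: H_def multisets_of_size_def)
    have "matching_dist d R H \<le> d i r + matching_dist d R' R'"
      unfolding R' H_def by (rule matching_dist_add) simp
    also have "matching_dist d R' R' = 0" by (rule matching_dist_zero) (use R'M in auto)
    finally have cost: "matching_dist d R H \<le> dist (e i) (e r)" using e iM r by simp
    have "conf_dist (image_mset e (add_mset s' R')) {#e s', x', y'#} \<le> dist (e s') (e s') + conf_dist (image_mset e R') {#x', y'#}"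
      using R'M conf_dist_add[of "image_mset e R'" "{#x', y'#}" "e s'" "e s'"] by simp
    then have 1: "matching_dist d R H + conf_dist (image_mset e (add_mset s' R')) {#e s', x', y'#} \<le> conf_dist ?R {#e r, x', y'#}"
      using cost i(2) R' by simp
    have "conf_dist {#e s, x, y#} {#e r, x', y'#} \<le> conf_dist {#e r, x, y#} {#e r, x, y#} + a"
      using step(3) unfolding server_move_def by blast
    then have "conf_dist {#e s, x, y#} {#e r, x', y'#} \<le> a" by (simp add: conf_dist_refl)
    moreover have "conf_dist ?R {#e r, x', y'#} \<le> conf_dist ?R {#e s, x, y#} + conf_dist {#e s, x, y#} {#e r, x', y'#}"
      using RM by (intro conf_dist_triangle) auto
    ultimately have alg: "matching_dist d R H + conf_dist (image_mset e (add_mset s' R')) {#e s', x', y'#}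
      \<le> conf_dist ?R {#e s, x, y#} + a" using 1 by linarith
    have opt: "\<exists>p\<in>M. \<exists>t\<in>M. taxi_end C0 (rs @ [(r, s')]) Hs' = {#s', p, t#} \<and>
        c + matching_dist d R H + conf_dist (image_mset e (add_mset s' R')) {#e s', x', y'#} + F' (e p) (e t)
          \<le> 10^14 * taxi_cost d C0 (rs @ [(r, s')]) Hs'"
      if "serves M 3 (rs @ [(r, s')]) Hs'" for Hs'
    proof -
      from serves_snocE[OF that] obtain Hs G where Hs: "Hs' = Hs @ [G]" "serves M 3 rs Hs"
        "G \<in> multisets_of_size M 3" "r \<in># G" by blast
      obtain p t where pt: "p \<in> M" "t \<in> M" "taxi_end C0 rs Hs = {#s, p, t#}"
        "c + conf_dist ?R {#e s, x, y#} + F (e p) (e t) \<le> 10^14 * taxi_cost d C0 rs Hs" using pot[OF Hs(2)] by blast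
      obtain p' t' where G: "G = {#r, p', t'#}"
      proof -
        obtain G' where G': "G = add_mset r G'" using Hs(4) by (meson multi_member_split)
        then have "size G' = 2" using Hs(3) by (simp add: multisets_of_size_def)
        then show thesis using that G' mset_size_2 by blast
      qed
      have M': "p' \<in> M" "t' \<in> M" using Hs(3) by (auto simp: G multisets_of_size_def)
      have pot': "F' (e p') (e t') + a \<le> F (e p) (e t) + 10^14 * conf_dist {#e s, e p, e t#} {#e r, e p', e t'#}"
        by (rule potential_offline_move[OF F step(1,2)])
      have "conf_dist (image_mset e {#s, p, t#}) (image_mset e {#r, p', t'#}) \<le> matching_dist d {#s, p, t#} {#r, p', t'#}"
        by (rule matching_dist_image) (use e s pt M' r in auto)
      then have "F' (e p') (e t') + a \<le> F (e p) (e t) + 10^14 * matching_dist d {#s, p, t#} G"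
        using pot' by (simp add: G)
      moreover have "taxi_cost d C0 (rs @ [(r, s')]) Hs' = taxi_cost d C0 rs Hs + matching_dist d {#s, p, t#} G"
        using taxi_cost_snoc[OF serves_length[OF Hs(2)], of d C0 r s' G] by (simp add: Hs(1) pt(3))
      moreover have "taxi_end C0 (rs @ [(r, s')]) Hs' = {#s', p', t'#}"
        using taxi_end_snoc[OF serves_length[OF Hs(2)], of C0 r s' G] by (simp add: Hs(1) G add_mset_commute)
      ultimately show ?thesis using M' alg pt(4) by (intro bexI[of _ p'] bexI[of _ t']) (auto simp: algebra_simps)
    qed
    have "W (rs @ [(r, s')]) (H - {#r#} + {#s'#}) (c + matching_dist d R H)"
      unfolding W_def H(3)
    proof (rule bexI[OF _ s'], intro exI conjI allI impI)
      show "alg_state x' y' F'" by (rule step)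
      show "add_mset s' R' \<in> multisets_of_size M 3" using s' R'M by (simp add: multisets_of_size_def)
    qed (use opt in blast)
    then show ?thesis using H by blast
  qed
  ultimately obtain A where A: "valid_online_alg M 3 A"
    "\<And>rs. rs \<in> lists (M \<times> M) \<Longrightarrow> \<exists>R. W rs R (taxi_cost d C0 rs (online_run A rs))"
    using online_alg_from_invariant[of W C0 M 3 d] by blast
  \<comment> \<open>The additive constant is 0: the virtual taxis start on the real ones, with
    potential zero at the initial offline pair.\<close>
  have "taxi_cost d C0 rs (online_run A rs) \<le> 10^14 * taxi_opt M d 3 C0 rs + 0" if rs: "rs \<in> lists (M \<times> M)" for rs
  proof -
    let ?c = "taxi_cost d C0 rs (online_run A rs)"
    have "?c / 10^14 \<le> taxi_cost d C0 rs Hs" if Hs: "serves M 3 rs Hs" for Hs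
    proof -
      obtain R s x y F p t where "alg_state x y F" "R \<in> multisets_of_size M 3"
        "?c + conf_dist (image_mset e R) {#e s, x, y#} + F (e p) (e t) \<le> 10^14 * taxi_cost d C0 rs Hs"
        using A(2)[OF rs] Hs unfolding W_def by blast
      moreover from this have "0 \<le> F (e p) (e t)" by (intro alg_state_nonneg)
      moreover have "0 \<le> conf_dist (image_mset e R) {#e s, x, y#}"
        using \<open>R \<in> _\<close> by (intro matching_dist_nonneg) (auto simp: multisets_of_size_def)
      ultimately show ?thesis by simp
    qed
    then have "?c / 10^14 \<le> taxi_opt M d 3 C0 rs" using rs by (intro taxi_opt_ge) auto
    then show ?thesis by simp
  qed
  then show ?thesis using A(1) unfolding competitive_def by blast
qed

section \<open>Transfer to arbitrary metric spaces\<close>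

text \<open>Positions from which the adversary, having revealed rs and forced the online cost c in
  configuration R, can violate the competitive bound with additive constant b.\<close>

inductive beats :: "'a set \<Rightarrow> ('a \<Rightarrow> 'a \<Rightarrow> real) \<Rightarrow> nat \<Rightarrow> 'a multiset \<Rightarrow> real \<Rightarrow> real \<Rightarrow>
    ('a \<times> 'a) list \<Rightarrow> 'a multiset \<Rightarrow> real \<Rightarrow> bool"
  for M d k C0 \<rho> b where
  beats_now: "\<rho> * taxi_opt M d k C0 rs + b < c \<Longrightarrow> beats M d k C0 \<rho> b rs R c"
| beats_request: "r \<in> M \<Longrightarrow> s \<in> M \<Longrightarrow>
    (\<And>H. H \<in> multisets_of_size M k \<Longrightarrow> r \<in># H \<Longrightarrow>
      beats M d k C0 \<rho> b (rs @ [(r, s)]) (H - {#r#} + {#s#}) (c + matching_dist d R H)) \<Longrightarrow>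
    beats M d k C0 \<rho> b rs R c"

text \<open>From a position that is not won by the adversary, every request has an answer leading to
  another such position. Staying among them forever means that the bound is never violated.\<close>

lemma unbeaten_algorithm:
  assumes "\<not> beats M d k C0 \<rho> b [] C0 0"
  shows "\<exists>A. valid_online_alg M k A \<and> competitive M d k C0 A \<rho>"
proof -
  have "\<exists>A. valid_online_alg M k A \<and>
      (\<forall>rs\<in>lists (M \<times> M). \<exists>R. \<not> beats M d k C0 \<rho> b rs R (taxi_cost d C0 rs (online_run A rs)))"
  proof (rule online_alg_from_invariant)
    fix rs R c r s
    assume *: "\<not> beats M d k C0 \<rho> b rs R c" "r \<in> M" "s \<in> M"
    show "\<exists>H. H \<in> multisets_of_size M k \<and> r \<in># H \<and>
      \<not> beats M d k C0 \<rho> b (rs @ [(r, s)]) (H - {#r#} + {#s#}) (c + matching_dist d R H)"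
      using beats_request[OF *(2,3), of k d C0 \<rho> b rs c R] *(1) by blast
  qed (rule assms)
  then show ?thesis unfolding competitive_def by (meson beats_now not_le)
qed

text \<open>A derivation of \<open>beats\<close> is well-founded, so following A along it ends after
  finitely many requests in a violated bound.\<close>

lemma algorithm_not_beaten:
  assumes A: "valid_online_alg M k A"
    and bound: "\<And>rs. rs \<in> lists (M \<times> M) \<Longrightarrow> taxi_cost d C0 rs (online_run A rs) \<le> \<rho> * taxi_opt M d k C0 rs + b"
    and beats: "beats M d k C0 \<rho> b rs R c"
    and "rs \<in> lists (M \<times> M)" "R = taxi_end C0 rs (online_run A rs)" "c = taxi_cost d C0 rs (online_run A rs)"
  shows False
  using beats assms(4-)
proof (induction rule: beats.induct)
  case (beats_now rs c R)
  then show ?case using bound[of rs] by simp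
next
  case (beats_request r s rs c R)
  let ?rs = "rs @ [(r, s)]" and ?H = "A (rs @ [(r, s)])"
  have rs: "?rs \<in> lists (M \<times> M)" using beats_request by auto
  then have "serves M k ?rs (online_run A rs @ [?H])"
    using A unfolding valid_online_alg_def by (metis online_run_snoc)
  then have H: "serves M k rs (online_run A rs)" "?H \<in> multisets_of_size M k" "r \<in># ?H"
    by (simp_all add: serves_snoc)
  show ?case
    using beats_request.IH[OF H(2,3) rs] beats_request.prems taxi_cost_snoc[OF serves_length[OF H(1)]]
      taxi_end_snoc[OF serves_length[OF H(1)]]
    by (simp add: online_run_snoc)
qed

lemma taxi_cost_nonneg:
  assumes "Metric_space M d"
  shows "C \<in> multisets_of_size M k \<Longrightarrow> rs \<in> lists (M \<times> M) \<Longrightarrow> serves M k rs Hs \<Longrightarrow> 0 \<le> taxi_cost d C rs Hs"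
proof (induction Hs arbitrary: rs C)
  case Nil
  then show ?case by simp
next
  case (Cons H Hs)
  interpret Metric_space M d by fact
  obtain r s rs' where rs: "rs = (r, s) # rs'"
    using Cons.prems(3) unfolding serves_def by (auto simp: list_all2_Cons2)
  then have H: "H \<in> multisets_of_size M k" "r \<in># H" "serves M k rs' Hs" "s \<in> M" "rs' \<in> lists (M \<times> M)"
    using Cons.prems(2,3) unfolding serves_def by auto
  obtain H' where H': "H = add_mset r H'" using H(2) by (meson multi_member_split)
  have "H - {#r#} + {#s#} \<in> multisets_of_size M k"
    using H(1,4) unfolding H' by (simp add: multisets_of_size_def)
  from Cons.IH[OF this H(5,3)] have "0 \<le> taxi_cost d (H - {#r#} + {#s#}) rs' Hs" .
  moreover have "0 \<le> matching_dist d C H"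
    using Cons.prems(1) H(1) by (intro matching_dist_nonneg) (auto simp: multisets_of_size_def)
  ultimately show ?case by (simp add: rs)
qed

section \<open>Passing to countable subspaces\<close>

lemma serves_iff_UNIV: "serves M k rs Hs \<longleftrightarrow> serves UNIV k rs Hs \<and> (\<forall>H\<in>set Hs. set_mset H \<subseteq> M)"
  unfolding serves_def
proof (induction rs arbitrary: Hs)
  case (Cons q rs)
  then show ?case by (cases Hs) (auto simp: multisets_of_size_def)
qed auto

lemma bdd_below_taxi_cost:
  assumes "Metric_space M d" "C \<in> multisets_of_size M k" "rs \<in> lists (M \<times> M)"
  shows "bdd_below (taxi_cost d C rs ` {Hs. serves M k rs Hs})"
  using taxi_cost_nonneg[OF assms] by (intro bdd_belowI2[where m = 0]) blast

text \<open>A subspace admits fewer schedules, so its optimum could be larger. Keeping all points of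
  a sequence of schedules whose costs tend to the infimum prevents this. Equality is wanted because
  the sign of \<rho> in \<open>beats\<close> is unknown.\<close>

lemma taxi_opt_countable_support:
  assumes M: "Metric_space M d" "C0 \<in> multisets_of_size M k" and k: "0 < k" and rs: "rs \<in> lists (M \<times> M)"
  obtains S where "countable S" "S \<subseteq> M"
    "\<And>N. S \<subseteq> N \<Longrightarrow> N \<subseteq> M \<Longrightarrow> taxi_opt N d k C0 rs = taxi_opt M d k C0 rs"
proof -
  let ?X = "\<lambda>N. taxi_cost d C0 rs ` {Hs. serves N k rs Hs}"
  have ne: "?X M \<noteq> {}" using serves_exists[OF k rs] by auto
  note bdd = bdd_below_taxi_cost[OF M rs]
  have "\<exists>Hs. serves M k rs Hs \<and> taxi_cost d C0 rs Hs < taxi_opt M d k C0 rs + 1 / real (Suc j)" for j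
    using cInf_lessD[OF ne, of "taxi_opt M d k C0 rs + 1 / real (Suc j)"] unfolding taxi_opt_def by auto
  then obtain Hs where Hs: "\<And>j. serves M k rs (Hs j)"
    "\<And>j. taxi_cost d C0 rs (Hs j) < taxi_opt M d k C0 rs + 1 / real (Suc j)" by metis
  define S where "S = (\<Union>j. \<Union>H\<in>set (Hs j). set_mset H)"
  have SM: "S \<subseteq> M"
    using Hs(1) unfolding S_def serves_iff_UNIV[of M] by blast
  have "taxi_opt N d k C0 rs = taxi_opt M d k C0 rs" if N: "S \<subseteq> N" "N \<subseteq> M" for N
  proof (rule antisym)
    have sub: "?X N \<subseteq> ?X M"
      using N(2) unfolding serves_iff_UNIV[of M] serves_iff_UNIV[of N] by blast
    have HsN: "serves N k rs (Hs j)" for j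
      using Hs(1)[of j] N(1) unfolding serves_iff_UNIV[of M] serves_iff_UNIV[of N] S_def by blast
    have bddN: "bdd_below (?X N)" using bdd sub by (rule bdd_below_mono)
    have approx: "taxi_opt N d k C0 rs \<le> taxi_opt M d k C0 rs + 1 / real (Suc j)" for j
      unfolding taxi_opt_def[of N] using HsN[of j] Hs(2)[of j] by (intro cINF_lower2[OF bddN]) auto
    have "taxi_opt N d k C0 rs \<le> taxi_opt M d k C0 rs + e" if "0 < e" for e
    proof -
      obtain j where "1 / real (Suc j) < e" by (rule nat_approx_posE[OF \<open>0 < e\<close>])
      with approx[of j] show ?thesis by linarith
    qed
    then show "taxi_opt N d k C0 rs \<le> taxi_opt M d k C0 rs" by (rule field_le_epsilon)
    show "taxi_opt M d k C0 rs \<le> taxi_opt N d k C0 rs"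
      unfolding taxi_opt_def using HsN bdd sub by (intro cInf_superset_mono) auto
  qed
  moreover have "countable S" unfolding S_def by (simp add: countable_finite)
  ultimately show ?thesis using that SM by blast
qed

text \<open>Formulated with finite subsets so that closures are reached by countable iteration.\<close>

definition closed_under :: "('a set \<Rightarrow> 'a set) \<Rightarrow> 'a set \<Rightarrow> bool" where
  "closed_under \<phi> N \<longleftrightarrow> (\<forall>F. finite F \<and> F \<subseteq> N \<longrightarrow> \<phi> F \<subseteq> N)"

lemma countable_closure:
  fixes \<phi> :: "nat \<Rightarrow> 'a set \<Rightarrow> 'a set"
  assumes "countable S" "S \<subseteq> M" "\<And>n F. finite F \<Longrightarrow> countable (\<phi> n F)" "\<And>n F. \<phi> n F \<subseteq> M"
  obtains N where "countable N" "S \<subseteq> N" "N \<subseteq> M" "\<And>n. closed_under (\<phi> n) N"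
proof -
  define grow where "grow N = N \<union> (\<Union>n. \<Union>F\<in>{F. finite F \<and> F \<subseteq> N}. \<phi> n F)" for N
  define T where "T i = (grow ^^ i) S" for i
  have T_Suc: "T (Suc i) = grow (T i)" and T0: "T 0 = S" for i by (simp_all add: T_def)
  have cT: "countable (T i)" for i
  proof (induction i)
    case (Suc i)
    have "countable {F. finite F \<and> F \<subseteq> T i}" using Suc by (rule countable_Collect_finite_subset)
    then show ?case unfolding T_Suc grow_def using Suc assms(3) by (intro countable_Un countable_UN) auto
  qed (use assms T0 in simp)
  have TM: "T i \<subseteq> M" for i
  proof (induction i)
    case (Suc i)
    then show ?case unfolding T_Suc grow_def using assms(4) by blast
  qed (use assms(2) T0 in simp)
  have "incseq T" by (intro incseq_SucI) (auto simp: T_Suc grow_def)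
  define N where "N = (\<Union>i. T i)"
  have "closed_under (\<phi> n) N" for n
    unfolding closed_under_def
  proof (intro allI impI)
    fix F assume F: "finite F \<and> F \<subseteq> N"
    from F have "finite F" "F \<subseteq> N" by auto
    then have "\<exists>i. F \<subseteq> T i"
    proof (induction F rule: finite_induct)
      case (insert x F)
      then obtain i j where "F \<subseteq> T i" "x \<in> T j" by (auto simp: N_def)
      moreover have "T i \<subseteq> T (max i j)" "T j \<subseteq> T (max i j)"
        using \<open>incseq T\<close> by (simp_all add: incseqD)
      ultimately show ?case by blast
    qed simp
    then obtain i where "F \<subseteq> T i" by blast
    then have "\<phi> n F \<subseteq> T (Suc i)" using F by (auto simp: T_Suc grow_def)
    then show "\<phi> n F \<subseteq> N" by (auto simp: N_def)
  qed
  moreover have "countable N" "S \<subseteq> N" "N \<subseteq> M" using cT TM T0 by (auto simp: N_def)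
  ultimately show ?thesis using that by blast
qed

lemma beats_countable_support:
  assumes M: "Metric_space M d" "C0 \<in> multisets_of_size M k" and k: "0 < k"
    and "beats M d k C0 \<rho> b rs R c" "rs \<in> lists (M \<times> M)"
  shows "\<exists>\<phi>. (\<forall>F. \<phi> F \<subseteq> M \<and> (finite F \<longrightarrow> countable (\<phi> F))) \<and>
    (\<forall>N. N \<subseteq> M \<and> closed_under \<phi> N \<longrightarrow> beats N d k C0 \<rho> b rs R c)"
  using assms(4,5)
proof (induction rule: beats.induct)
  case (beats_now rs c R)
  obtain S where S: "countable S" "S \<subseteq> M"
    "\<And>N. S \<subseteq> N \<Longrightarrow> N \<subseteq> M \<Longrightarrow> taxi_opt N d k C0 rs = taxi_opt M d k C0 rs"
    using taxi_opt_countable_support[OF M k beats_now(2)] by blast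
  have "beats N d k C0 \<rho> b rs R c" if "N \<subseteq> M" "closed_under (\<lambda>F. S) N" for N
  proof (rule beats.beats_now)
    have "S \<subseteq> N" using that(2)[unfolded closed_under_def, rule_format, of "{}"] by simp
    then show "\<rho> * taxi_opt N d k C0 rs + b < c" using S(3)[OF _ that(1)] beats_now(1) by simp
  qed
  then show ?case using S(1,2) by (intro exI[of _ "\<lambda>F. S"]) auto
next
  case (beats_request r s rs c R)
  let ?P = "\<lambda>H \<phi>. (\<forall>F. \<phi> F \<subseteq> M \<and> (finite F \<longrightarrow> countable (\<phi> F))) \<and>
    (\<forall>N. N \<subseteq> M \<and> closed_under \<phi> N \<longrightarrow>
      beats N d k C0 \<rho> b (rs @ [(r, s)]) (H - {#r#} + {#s#}) (c + matching_dist d R H))"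
  have rs: "rs @ [(r, s)] \<in> lists (M \<times> M)" using beats_request.hyps(1,2) beats_request.prems by simp
  have "\<forall>H. \<exists>\<phi>. H \<in> multisets_of_size M k \<and> r \<in># H \<longrightarrow> ?P H \<phi>"
  proof
    fix H
    show "\<exists>\<phi>. H \<in> multisets_of_size M k \<and> r \<in># H \<longrightarrow> ?P H \<phi>"
    proof (cases "H \<in> multisets_of_size M k \<and> r \<in># H")
      case True
      then have "\<exists>\<phi>. ?P H \<phi>" by (intro beats_request.IH[OF _ _ rs]) auto
      then show ?thesis by blast
    qed blast
  qed
  from choice[OF this] obtain \<psi> where "\<forall>H. H \<in> multisets_of_size M k \<and> r \<in># H \<longrightarrow> ?P H (\<psi> H)" ..
  then have \<psi>: "\<And>H. H \<in> multisets_of_size M k \<Longrightarrow> r \<in># H \<Longrightarrow> ?P H (\<psi> H)" by blast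
  \<comment> \<open>F has to supply both the points of H and the argument of
    \<open>\<psi> H\<close>. A set closed under \<phi> is then closed under \<open>\<psi> H\<close>
    for every H inside it: apply \<phi> to the given finite set enlarged by the points of H. A
    finite F carries finitely many H, so \<phi> F stays countable.\<close>
  define \<phi> where "\<phi> F = {r, s} \<union> (\<Union>H\<in>{H \<in> multisets_of_size (F \<inter> M) k. r \<in># H}. \<Union>F'\<in>Pow F. \<psi> H F')" for F
  have sub: "H \<in> multisets_of_size M k" if "H \<in> multisets_of_size (F \<inter> M) k" for H F
    using that by (auto simp: multisets_of_size_def)
  have "\<phi> F \<subseteq> M" for F
    unfolding \<phi>_def using beats_request.hyps(1,2) \<psi> sub by blast
  moreover have "countable (\<phi> F)" if "finite F" for F
  proof -
    have fin: "finite {H \<in> multisets_of_size (F \<inter> M) k. r \<in># H}"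
      using that by (simp add: finite_multisets_of_size)
    have cnt: "countable (\<psi> H F')" if H: "H \<in> {H \<in> multisets_of_size (F \<inter> M) k. r \<in># H}" and F': "F' \<in> Pow F" for H F'
    proof -
      have "finite F'" using F' \<open>finite F\<close> finite_subset by blast
      then show ?thesis using \<psi>[of H] sub[of H F] H by blast
    qed
    have "countable (\<Union>F'\<in>Pow F. \<psi> H F')" if "H \<in> {H \<in> multisets_of_size (F \<inter> M) k. r \<in># H}" for H
      using \<open>finite F\<close> cnt[OF that] by (intro countable_UN[OF countable_finite]) simp_all
    then have "countable (\<Union>H\<in>{H \<in> multisets_of_size (F \<inter> M) k. r \<in># H}. \<Union>F'\<in>Pow F. \<psi> H F')"
      by (rule countable_UN[OF countable_finite[OF fin]])
    then show ?thesis unfolding \<phi>_def by simp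
  qed
  moreover have "beats N d k C0 \<rho> b rs R c" if N: "N \<subseteq> M" "closed_under \<phi> N" for N
  proof (rule beats.beats_request)
    have "\<phi> {} \<subseteq> N" using N(2)[unfolded closed_under_def, rule_format, of "{}"] by simp
    then show "r \<in> N" "s \<in> N" by (auto simp: \<phi>_def)
    fix H assume H: "H \<in> multisets_of_size N k" "r \<in># H"
    then have HM: "H \<in> multisets_of_size M k" using N(1) by (auto simp: multisets_of_size_def)
    have "closed_under (\<psi> H) N"
      unfolding closed_under_def
    proof (intro allI impI)
      fix F assume F: "finite F \<and> F \<subseteq> N"
      let ?F = "F \<union> set_mset H"
      have "finite ?F \<and> ?F \<subseteq> N" using F H(1) by (auto simp: multisets_of_size_def)
      then have "\<phi> ?F \<subseteq> N" using N(2) unfolding closed_under_def by blast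
      moreover have "H \<in> {H \<in> multisets_of_size (?F \<inter> M) k. r \<in># H}"
        using H HM by (auto simp: multisets_of_size_def)
      then have "\<psi> H F \<subseteq> \<phi> ?F" unfolding \<phi>_def by blast
      ultimately show "\<psi> H F \<subseteq> N" by blast
    qed
    then show "beats N d k C0 \<rho> b (rs @ [(r, s)]) (H - {#r#} + {#s#}) (c + matching_dist d R H)"
      using \<psi>[OF HM H(2)] N(1) by blast
  qed
  ultimately have "(\<forall>F. \<phi> F \<subseteq> M \<and> (finite F \<longrightarrow> countable (\<phi> F))) \<and>
    (\<forall>N. N \<subseteq> M \<and> closed_under \<phi> N \<longrightarrow> beats N d k C0 \<rho> b rs R c)" by simp
  then show ?case by (rule exI[of _ \<phi>])
qed

section \<open>Invariance under isometries\<close>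

lemma matching_dist_isometry:
  assumes "size C = size D" "set_mset C \<subseteq> N" "set_mset D \<subseteq> N"
    and "\<And>x. x \<in> N \<Longrightarrow> g (f x) = x" "\<And>x y. x \<in> N \<Longrightarrow> y \<in> N \<Longrightarrow> d' (f x) (f y) = d x y"
  shows "matching_dist d' (image_mset f C) (image_mset f D) = matching_dist d C D"
proof (rule antisym)
  show "matching_dist d' (image_mset f C) (image_mset f D) \<le> matching_dist d C D"
    by (intro matching_dist_image) (simp_all add: assms(1,5) subsetD[OF assms(2)] subsetD[OF assms(3)])
  have id: "image_mset g (image_mset f E) = E" if "set_mset E \<subseteq> N" for E
  proof -
    have "image_mset (\<lambda>x. g (f x)) E = image_mset (\<lambda>x. x) E"
      using that assms(4) by (intro image_mset_cong) auto
    then show ?thesis by (simp add: multiset.map_comp comp_def)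
  qed
  have "matching_dist d (image_mset g (image_mset f C)) (image_mset g (image_mset f D))
      \<le> matching_dist d' (image_mset f C) (image_mset f D)"
    by (intro matching_dist_image)
      (auto simp: assms(1,4,5) subsetD[OF assms(2)] subsetD[OF assms(3)])
  then show "matching_dist d C D \<le> matching_dist d' (image_mset f C) (image_mset f D)"
    using id assms(2,3) by simp
qed

lemma serves_image:
  assumes "\<And>x. x \<in> N \<Longrightarrow> f x \<in> N'" "serves N k rs Hs"
  shows "serves N' k (map (map_prod f f) rs) (map (image_mset f) Hs)"
  using assms(2) unfolding serves_def list_all2_map1 list_all2_map2
  by (rule list_all2_mono) (use assms(1) in \<open>auto simp: multisets_of_size_def subset_iff\<close>)

lemma taxi_cost_isometry:
  assumes iso: "\<And>x. x \<in> N \<Longrightarrow> g (f x) = x" "\<And>x y. x \<in> N \<Longrightarrow> y \<in> N \<Longrightarrow> d' (f x) (f y) = d x y"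
  shows "C \<in> multisets_of_size N k \<Longrightarrow> rs \<in> lists (N \<times> N) \<Longrightarrow> serves N k rs Hs \<Longrightarrow>
    taxi_cost d' (image_mset f C) (map (map_prod f f) rs) (map (image_mset f) Hs) = taxi_cost d C rs Hs"
proof (induction Hs arbitrary: rs C)
  case Nil
  then show ?case by simp
next
  case (Cons H Hs)
  obtain r s rs' where rs: "rs = (r, s) # rs'"
    using Cons.prems(3) unfolding serves_def by (auto simp: list_all2_Cons2)
  then have H: "H \<in> multisets_of_size N k" "r \<in># H" "serves N k rs' Hs" "s \<in> N" "rs' \<in> lists (N \<times> N)"
    using Cons.prems(2,3) unfolding serves_def by auto
  obtain H' where H': "H = add_mset r H'" using H(2) by (meson multi_member_split)
  have "H - {#r#} + {#s#} \<in> multisets_of_size N k"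
    using H(1,4) unfolding H' by (simp add: multisets_of_size_def)
  from Cons.IH[OF this H(5,3)]
  have "taxi_cost d' (image_mset f (add_mset s H')) (map (map_prod f f) rs') (map (image_mset f) Hs) =
    taxi_cost d (add_mset s H') rs' Hs" by (simp add: H')
  moreover have "matching_dist d' (image_mset f C) (image_mset f H) = matching_dist d C H"
    by (rule matching_dist_isometry[where N = N and g = g]) (use Cons.prems(1) H(1) iso in \<open>auto simp: multisets_of_size_def\<close>)
  ultimately show ?case by (simp add: rs H')
qed

lemma taxi_costs_isometry_subset:
  assumes "\<And>x. x \<in> N \<Longrightarrow> f x \<in> N' \<and> g (f x) = x" "\<And>x y. x \<in> N \<Longrightarrow> y \<in> N \<Longrightarrow> d' (f x) (f y) = d x y"
    and "C \<in> multisets_of_size N k" "rs \<in> lists (N \<times> N)"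
  shows "taxi_cost d C rs ` {Hs. serves N k rs Hs} \<subseteq>
    taxi_cost d' (image_mset f C) (map (map_prod f f) rs) ` {Hs. serves N' k (map (map_prod f f) rs) Hs}"
proof (rule image_subsetI)
  fix Hs assume "Hs \<in> {Hs. serves N k rs Hs}"
  then have Hs: "serves N k rs Hs" by simp
  have "serves N' k (map (map_prod f f) rs) (map (image_mset f) Hs)"
    using assms(1) Hs by (intro serves_image) auto
  moreover have "taxi_cost d' (image_mset f C) (map (map_prod f f) rs) (map (image_mset f) Hs) = taxi_cost d C rs Hs"
    using assms Hs by (intro taxi_cost_isometry[where N = N and g = g and k = k]) auto
  ultimately show "taxi_cost d C rs Hs \<in>
    taxi_cost d' (image_mset f C) (map (map_prod f f) rs) ` {Hs. serves N' k (map (map_prod f f) rs) Hs}"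
    by (metis (mono_tags, lifting) image_eqI mem_Collect_eq)
qed

lemma algorithm_isometry:
  assumes f: "\<And>x. x \<in> N \<Longrightarrow> f x \<in> N' \<and> g (f x) = x" and g: "\<And>x. x \<in> N' \<Longrightarrow> g x \<in> N \<and> f (g x) = x"
    and d: "\<And>x y. x \<in> N \<Longrightarrow> y \<in> N \<Longrightarrow> d' (f x) (f y) = d x y"
    and C: "C \<in> multisets_of_size N k"
    and A: "valid_online_alg N' k A'" "competitive N' d' k (image_mset f C) A' \<rho>"
  shows "\<exists>A. valid_online_alg N k A \<and> competitive N d k C A \<rho>"
proof -
  let ?f = "map (map_prod f f)" and ?g = "map (map_prod g g)"
  define A where "A rs = image_mset g (A' (?f rs))" for rs
  have run: "online_run A rs = map (image_mset g) (online_run A' (?f rs))" for rs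
    by (simp add: online_run_def A_def take_map)
  have gf: "?g (?f rs) = rs" if "rs \<in> lists (N \<times> N)" for rs
    using that f by (induction rs) auto
  have rs': "?f rs \<in> lists (N' \<times> N')" if "rs \<in> lists (N \<times> N)" for rs
    using that f by (induction rs) auto
  have C': "image_mset f C \<in> multisets_of_size N' k" using C f by (auto simp: multisets_of_size_def)
  have "image_mset (\<lambda>x. g (f x)) C = image_mset (\<lambda>x. x) C"
    using C f by (intro image_mset_cong) (auto simp: multisets_of_size_def)
  then have gfC: "image_mset g (image_mset f C) = C" by (simp add: multiset.map_comp comp_def)
  have d': "d (g x) (g y) = d' x y" if "x \<in> N'" "y \<in> N'" for x y
    using d[of "g x" "g y"] g that by simp
  have "valid_online_alg N k A"
    unfolding valid_online_alg_def
  proof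
    fix rs assume rs: "rs \<in> lists (N \<times> N)"
    then have "serves N' k (?f rs) (online_run A' (?f rs))"
      using A(1) rs' unfolding valid_online_alg_def by blast
    then have "serves N k (?g (?f rs)) (map (image_mset g) (online_run A' (?f rs)))"
      using g by (intro serves_image) auto
    then show "serves N k rs (online_run A rs)" using gf[OF rs] run by simp
  qed
  moreover have "taxi_cost d C rs (online_run A rs) = taxi_cost d' (image_mset f C) (?f rs) (online_run A' (?f rs))"
    if rs: "rs \<in> lists (N \<times> N)" for rs
  proof -
    have "serves N' k (?f rs) (online_run A' (?f rs))"
      using A(1) rs'[OF rs] unfolding valid_online_alg_def by blast
    then have "taxi_cost d (image_mset g (image_mset f C)) (?g (?f rs)) (map (image_mset g) (online_run A' (?f rs)))
      = taxi_cost d' (image_mset f C) (?f rs) (online_run A' (?f rs))"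
      using g d' C' rs'[OF rs] by (intro taxi_cost_isometry[where N = N' and g = f and k = k]) auto
    then show ?thesis using gf[OF rs] gfC run by simp
  qed
  moreover have "taxi_opt N' d' k (image_mset f C) (?f rs) = taxi_opt N d k C rs" if rs: "rs \<in> lists (N \<times> N)" for rs
  proof -
    have "taxi_cost d C rs ` {Hs. serves N k rs Hs} \<subseteq>
        taxi_cost d' (image_mset f C) (?f rs) ` {Hs. serves N' k (?f rs) Hs}"
      using f d C rs by (intro taxi_costs_isometry_subset[where g = g]) auto
    moreover have "taxi_cost d' (image_mset f C) (?f rs) ` {Hs. serves N' k (?f rs) Hs} \<subseteq>
        taxi_cost d (image_mset g (image_mset f C)) (?g (?f rs)) ` {Hs. serves N k (?g (?f rs)) Hs}"
      using g d' C' rs'[OF rs] by (intro taxi_costs_isometry_subset[where g = f]) auto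
    ultimately show ?thesis unfolding taxi_opt_def gf[OF rs] gfC by (metis subset_antisym)
  qed
  ultimately show ?thesis
    using A(2) rs' unfolding competitive_def by (metis (no_types, lifting))
qed

lemma countable_space_algorithm:
  assumes nat: "achievable_ratio TYPE(nat) k \<rho>" and N: "countable N" "Metric_space N d" "C \<in> multisets_of_size N k"
  shows "\<exists>A. valid_online_alg N k A \<and> competitive N d k C A \<rho>"
proof -
  interpret Metric_space N d by fact
  obtain f :: "'a \<Rightarrow> nat" where f: "inj_on f N" using N(1) unfolding countable_def by blast
  define g where "g = inv_into N f"
  define d' where "d' i j = d (g i) (g j)" for i j
  have fg: "f x \<in> f ` N \<and> g (f x) = x" if "x \<in> N" for x using f that by (simp add: g_def)
  have gf: "g x \<in> N \<and> f (g x) = x" if "x \<in> f ` N" for x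
    using that by (simp add: g_def inv_into_into f_inv_into_f)
  have "Metric_space (f ` N) d'"
  proof
    show "0 \<le> d' x y" for x y by (simp add: d'_def)
    show "d' x y = d' y x" for x y by (simp add: d'_def commute)
    show "d' x y = 0 \<longleftrightarrow> x = y" if "x \<in> f ` N" "y \<in> f ` N" for x y
      using gf[OF that(1)] gf[OF that(2)] zero[of "g x" "g y"] by (metis d'_def)
    show "d' x z \<le> d' x y + d' y z" if "x \<in> f ` N" "y \<in> f ` N" "z \<in> f ` N" for x y z
      using gf that triangle[of "g x" "g y" "g z"] by (simp add: d'_def)
  qed
  moreover have "image_mset f C \<in> multisets_of_size (f ` N) k"
    using N(3) by (auto simp: multisets_of_size_def)
  ultimately obtain A' where "valid_online_alg (f ` N) k A'" "competitive (f ` N) d' k (image_mset f C) A' \<rho>"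
    using nat unfolding achievable_ratio_def by blast
  with fg gf N(3) show ?thesis
    by (intro algorithm_isometry[where f = f and g = g and N' = "f ` N" and d' = d']) (auto simp: d'_def)
qed

text \<open>A single countable subspace N is closed for all n at once. An algorithm on N comes with
  some additive constant c, and the adversary for an n above c, who wins inside N, refutes it.
  Nothing about \<rho> enters beyond its being achievable over nat.\<close>

lemma achievable_ratio_nat_transfer:
  fixes M :: "'a set"
  assumes nat: "achievable_ratio TYPE(nat) k \<rho>" and k: "0 < k"
    and M: "Metric_space M d" "C0 \<in> multisets_of_size M k"
  shows "\<exists>A. valid_online_alg M k A \<and> competitive M d k C0 A \<rho>"
proof (cases "\<exists>n :: nat. \<not> beats M d k C0 \<rho> (real n) [] C0 0")
  case True
  then show ?thesis using unbeaten_algorithm by blast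
next
  case False
  have "\<exists>\<phi>. (\<forall>F. \<phi> F \<subseteq> M \<and> (finite F \<longrightarrow> countable (\<phi> F))) \<and>
    (\<forall>N. N \<subseteq> M \<and> closed_under \<phi> N \<longrightarrow> beats N d k C0 \<rho> (real n) [] C0 0)" for n :: nat
    using False by (intro beats_countable_support[OF M k]) auto
  then obtain \<phi> where \<phi>: "\<And>n F. \<phi> n F \<subseteq> M" "\<And>n F. finite F \<Longrightarrow> countable (\<phi> n F)"
    "\<And>n N. N \<subseteq> M \<Longrightarrow> closed_under (\<phi> n) N \<Longrightarrow> beats N d k C0 \<rho> (real n) [] C0 0"
    by metis
  obtain N where N: "countable N" "set_mset C0 \<subseteq> N" "N \<subseteq> M" "\<And>n. closed_under (\<phi> n) N"
    using countable_closure[of "set_mset C0" M \<phi>] \<phi>(1,2) M(2) by (auto simp: multisets_of_size_def countable_finite)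
  interpret Metric_space M d by fact
  have C0: "C0 \<in> multisets_of_size N k" using N(2) M(2) by (simp add: multisets_of_size_def)
  obtain A c where A: "valid_online_alg N k A"
    "\<And>rs. rs \<in> lists (N \<times> N) \<Longrightarrow> taxi_cost d C0 rs (online_run A rs) \<le> \<rho> * taxi_opt N d k C0 rs + c"
    using countable_space_algorithm[OF nat N(1) subspace[OF N(3)] C0] unfolding competitive_def by blast
  obtain n :: nat where n: "c \<le> real n" using real_arch_simple by blast
  have "taxi_cost d C0 rs (online_run A rs) \<le> \<rho> * taxi_opt N d k C0 rs + real n" if "rs \<in> lists (N \<times> N)" for rs
    using A(2)[OF that] n by linarith
  from algorithm_not_beaten[OF A(1) this \<phi>(3)[OF N(3,4), of n]] have False by simp
  then show ?thesis ..
qed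

lemma achievable_ratio_nat: "achievable_ratio TYPE(nat) 3 (10^14)"
proof -
  have "\<exists>A. Metric_space M d \<and> C0 \<in> multisets_of_size M 3 \<longrightarrow>
      valid_online_alg M 3 A \<and> competitive M d 3 C0 A (10^14)" for M :: "nat set" and d C0
    using competitive_algorithm_nat by blast
  then show ?thesis unfolding achievable_ratio_def by metis
qed

theorem theorem1:
  shows "\<exists>ALG. \<forall>(M :: 'a set) (d :: 'a \<Rightarrow> 'a \<Rightarrow> real) (C0 :: 'a multiset).
           Metric_space M d \<and> C0 \<in> multisets_of_size M 3 \<longrightarrow>
             valid_online_alg M 3 (ALG M d C0) \<and>
             competitive M d 3 C0 (ALG M d C0) (absolute_taxi_ratio 3)"
proof -
  have "achievable_ratio TYPE(nat) 3 (absolute_taxi_ratio 3)"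
    unfolding absolute_taxi_ratio_def by (rule someI, rule achievable_ratio_nat)
  then have "\<exists>A. Metric_space M d \<and> C0 \<in> multisets_of_size M 3 \<longrightarrow>
      valid_online_alg M 3 A \<and> competitive M d 3 C0 A (absolute_taxi_ratio 3)"
    for M :: "'a set" and d C0
    using achievable_ratio_nat_transfer[of 3 "absolute_taxi_ratio 3" M d C0] by auto
  then show ?thesis by metis
qed

end
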